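(* Let $\boldsymbol{B}\in\mathbb{R}^{n\times n}$ ($n\geq2$) be upper triangular with distinct diagonal elements $B_{11}>\cdots>B_{nn}$. Put $b_i=B_{ii}$. Let $f$ be a measurable real-valued function defined in a neighbourhood of infinity, and let $g_n$ be a measurable real-valued function defined in a neighbourhood of infinity, eventually of constant sign, with $|g_n|$ regularly varying of index $b_n$. Then $f\in GRV(\boldsymbol{g})$ for some $\boldsymbol{g}\in R_{\boldsymbol{B}}$ with last component $g_n$ if and only if there exist $a\in(0,\infty)$ and $a_0,\ldots,a_n\in\mathbb{R}$ such that, as $t\to\infty$, $$f(t)=a_0+\sum_{i=1}^{n-1}a_i\int_1^t u^{b_i-1}\,\mathrm{d}u+\int_a^t\{a_n+o(1)\}\,g_n(u)\,u^{-1}\,\mathrm{d}u+o(g_n(t)).$$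
   Context: In the displayed representation, $o(1)$ under the integral stands for a measurable function of $u$ on $[a,\infty)$ tending to $0$ as $u\to\infty$ (with the integrals existing). Limit relations are as $t\to\infty$; measurability is Lebesgue. A positive measurable function $F$ defined in a neighbourhood of infinity is regularly varying of index $\rho$ if $F(xt)/F(t)\to x^\rho$ for every $x>0$. A real function is defined in a neighbourhood of infinity if its domain contains some $[t_0,\infty)$; it is eventually of constant sign if it is either strictly positive for all large $t$ or strictly negative for all large $t$. A rate vector of length $n$ is a column vector $\boldsymbol{g}=(g_1,\ldots,g_n)'$ of real-valued functions defined in a neighbourhood of infinity, each eventually of constant sign, with $g_{i+1}(t)=o(g_i(t))$ for every $i\in\{1,\ldots,n-1\}$; $o(g_n(t))$ means $o(|g_n(t)|)$, componentwise for vectors. For a square matrix $\boldsymbol{B}$ and $x>0$, $x^{\boldsymbol{B}}=\exp\{(\log x)\boldsymbol{B}\}$. A rate vector $\boldsymbol{g}$ is regularly varying with index matrix $\boldsymbol{B}$, written $\boldsymbol{g}\in R_{\boldsymbol{B}}$, if $\boldsymbol{g}$ is measurable and $\boldsymbol{g}(xt)=x^{\boldsymbol{B}}\boldsymbol{g}(t)+o(g_n(t))$ for every $x\in(0,\infty)$. For $\boldsymbol{g}\in R_{\boldsymbol{B}}$, a measurable real-valued function $f$ defined in a neighbourhood of infinity is generalised regularly varying with rate vector $\boldsymbol{g}$, written $f\in GRV(\boldsymbol{g})$, if there is $\boldsymbol{c}\in\mathbb{R}^{1\times n}$ such that for every $x\in(0,\infty)$, $f(xt)=f(t)+\boldsymbol{h}(x)\boldsymbol{g}(t)+o(g_n(t))$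 with $\boldsymbol{h}(x)=\boldsymbol{c}\int_1^x y^{\boldsymbol{B}}y^{-1}\,\mathrm{d}y$. *)

theory Defs
  imports
    "HOL-Analysis.Analysis"
    "HOL-Library.Landau_Symbols"
    "Jordan_Normal_Form.Matrix"
begin

unbundle no vec_syntax

text \<open>
  A function defined in a neighbourhood of infinity is a total function \<open>real \<Rightarrow> real\<close> of which
  only the values on some half-line \<open>{t0..}\<close> are meaningful, and measurability is required on such
  a half-line only. The predicates below do not depend on the values outside the half-line.
  Vectors and matrices are indexed from \<open>0\<close>, so the \<open>i\<close>-th component of a vector of length \<open>n\<close>
  is \<open>v $ (i - 1)\<close> and the last one is \<open>v $ (n - 1)\<close>.
\<close>

definition measurable_near_top :: "(real \<Rightarrow> real) \<Rightarrow> bool" where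
  "measurable_near_top F \<longleftrightarrow> (\<exists>t0. F \<in> borel_measurable (lebesgue_on {t0..}))"

definition eventually_constant_sign :: "(real \<Rightarrow> real) \<Rightarrow> bool" where
  "eventually_constant_sign F \<longleftrightarrow>
     (\<forall>\<^sub>F t in at_top. F t > 0) \<or> (\<forall>\<^sub>F t in at_top. F t < 0)"

definition regularly_varying :: "real \<Rightarrow> (real \<Rightarrow> real) \<Rightarrow> bool" where
  "regularly_varying \<rho> F \<longleftrightarrow>
     measurable_near_top F \<and> (\<forall>\<^sub>F t in at_top. F t > 0) \<and>
     (\<forall>x>0. ((\<lambda>t. F (x * t) / F t) \<longlongrightarrow> x powr \<rho>) at_top)"

definition mat_exp :: "real mat \<Rightarrow> real mat" where
  "mat_exp A = mat (dim_row A) (dim_col A) (\<lambda>(i, j). \<Sum>k. (A ^\<^sub>m k) $$ (i, j) / fact k)"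

definition mat_powr :: "real \<Rightarrow> real mat \<Rightarrow> real mat" where
  "mat_powr x B = mat_exp (ln x \<cdot>\<^sub>m B)"

text \<open>
  The entrywise integral of \<open>y\<^sup>B y\<^sup>-\<^sup>1\<close> from \<open>1\<close> to \<open>x\<close>; the interval integral is oriented, so it
  changes sign for \<open>x < 1\<close>.
\<close>

definition mat_powr_integral :: "real mat \<Rightarrow> real \<Rightarrow> real mat" where
  "mat_powr_integral B x = mat (dim_row B) (dim_col B)
     (\<lambda>(i, j). LINT y=ereal 1..ereal x|lebesgue. (mat_powr y B $$ (i, j) * inverse y))"

definition vec_at :: "(real \<Rightarrow> real) vec \<Rightarrow> real \<Rightarrow> real vec" where
  "vec_at g t = map_vec (\<lambda>F. F t) g"

definition rate_vector :: "nat \<Rightarrow> (real \<Rightarrow> real) vec \<Rightarrow> bool" where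
  "rate_vector n g \<longleftrightarrow> g \<in> carrier_vec n \<and>
     (\<forall>i<n. eventually_constant_sign (g $ i)) \<and>
     (\<forall>i. i + 1 < n \<longrightarrow> g $ (i + 1) \<in> o[at_top](g $ i))"

definition RV_vec :: "real mat \<Rightarrow> (real \<Rightarrow> real) vec set" where
  "RV_vec B = {g. rate_vector (dim_row B) g \<and>
     (\<forall>i<dim_row B. measurable_near_top (g $ i)) \<and>
     (\<forall>x>0. \<forall>i<dim_row B.
        (\<lambda>t. vec_at g (x * t) $ i - (mat_powr x B *\<^sub>v vec_at g t) $ i)
          \<in> o[at_top](g $ (dim_row B - 1)))}"

text \<open>
  The class depends on \<open>B\<close> as well as on \<open>g\<close>; it is meant for \<open>g \<in> RV_vec B\<close>.
  The row vector \<open>c\<close> is a \<open>1 \<times> n\<close> matrix, and \<open>h(x) g(t)\<close> is the only component of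
  a matrix-vector product.
\<close>

definition GRV :: "real mat \<Rightarrow> (real \<Rightarrow> real) vec \<Rightarrow> (real \<Rightarrow> real) set" where
  "GRV B g = {f. measurable_near_top f \<and>
     (\<exists>c \<in> carrier_mat 1 (dim_row B). \<forall>x>0.
        (\<lambda>t. f (x * t) - (f t + ((c * mat_powr_integral B x) *\<^sub>v vec_at g t) $ 0))
          \<in> o[at_top](g $ (dim_row B - 1)))}"

end

(*
  Averaging f over [t, 2t] changes it by a constant multiple of g_n up to o(g_n) and makes it
  continuous, and a second averaging makes it continuously differentiable; the uniform convergence
  theorem for increments, applied first to ln |g_n| and then to f, controls the error. Subtracting
  a suitable multiple of the twofold average of g_n yields the one-dimensional representation.
  For the matrix case, diagonalize B = P D P^-1 with P unit upper triangular. The components of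
  P^-1 g satisfy scalar relations; except for the last one, which is g_n, they have the form
  C t^(b_i) + o(g_n), because increments that decay geometrically along t, 2t, 4t, ... can be summed.
  Conversely, g = P (t^(b_1), ..., t^(b_(n-1)), g_n)' is a rate vector that works for every f
  with a representation.
*)
theory Submission
  imports Defs "Jordan_Normal_Form.Determinant"
begin

section \<open>Uniform convergence of increments\<close>

text \<open>Averaging integrates the increment relation over x, while that relation is given only
  pointwise in x; this gap is why measurability is first turned into uniformity on compact x-sets.
  The second obstacle is that averaging alters both value and slope. Let m be the integral of x^b
  over [1, 2], and H that of h, where h(x) is the integral of u^(b-1) from 1 to x, so that m = 1 + b
  H. If f has increments c h(x) g_n, its twofold average F is f + c H (1 + m) g_n + o(g_n), with t
  F'(t) = c m^2 g_n(t) + o(g_n(t)). The function g_n obeys the same relation with c = b, so its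
  twofold average G is m^2 g_n + o(g_n). As m^2 - (m - 1)(m + 1) = 1, one multiple of G repairs both
  defects: F - p G is f + o(g_n) and has slope c g_n(t)/t up to o(g_n(t)/t). The o(1) under the
  integral is then read off from the derivative. In the matrix case, b_i > b_n makes g_n(t) t^(-b_i)
  shrink by a factor below 1 at each doubling of t; this is what makes the dyadic sums
  converge.\<close>

lemma measurable_near_topE:
  assumes "measurable_near_top f"
  obtains T0 where "T0 > 0" "\<And>T. T \<ge> T0 \<Longrightarrow> (\<lambda>t. indicator {T..} t * f t) \<in> borel_measurable lebesgue"
proof -
  from assms obtain t0 where t0: "f \<in> borel_measurable (lebesgue_on {t0..})"
    by (auto simp: measurable_near_top_def)
  show thesis
  proof (rule that[of "max t0 1"])
    fix T assume "T \<ge> max t0 1"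
    then have "f \<in> borel_measurable (lebesgue_on {T..})"
      using measurable_restrict_mono[OF t0] by auto
    then show "(\<lambda>t. indicator {T..} t * f t) \<in> borel_measurable lebesgue"
      by (simp add: borel_measurable_restrict_space_iff)
  qed simp
qed

lemma measurable_near_top_continuous:
  "continuous_on {T..} f \<Longrightarrow> measurable_near_top f"
  unfolding measurable_near_top_def
  by (auto intro!: exI[of _ T] continuous_imp_measurable_on_sets_lebesgue)

lemma filterlim_scale: "x > 0 \<Longrightarrow> filterlim (\<lambda>t. x * t :: real) at_top at_top"
  by (intro filterlim_tendsto_pos_mult_at_top[OF tendsto_const] filterlim_ident)

text \<open>By the cocycle relation the increment from t to x t is the difference of those from t to
  x v t and from x t to v (x t). A \<open>v\<close> at which both are accurate exists because the
  errors, truncated and integrated over y, tend to 0; these integrals do not involve x, so the bound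
  is uniform although \<open>v\<close> depends on x and t. Rate and factor stay general to cover
  both ln |g| with constant rate and f with rate g.\<close>

lemma uniform_limit_increments:
  fixes f g A k :: "real \<Rightarrow> real" and X C :: real
  assumes meas: "measurable_near_top f"
    and k: "continuous_on {1..} k"
    and X: "X \<ge> 1"
    and g: "\<forall>\<^sub>F t in at_top. g t \<noteq> 0"
    and A: "uniform_limit {1..X} (\<lambda>t x. g (x * t) / g t) A at_top"
    and Abd: "\<And>x. x \<in> {1..X} \<Longrightarrow> \<bar>A x\<bar> \<le> C"
    and cocycle: "\<And>x y. x \<ge> 1 \<Longrightarrow> y \<ge> 1 \<Longrightarrow> k (x * y) = k x + A x * k y"
    and lim: "\<And>x. x \<ge> 1 \<Longrightarrow> ((\<lambda>t. (f (x * t) - f t) / g t) \<longlongrightarrow> k x) at_top"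
  shows "uniform_limit {1..X} (\<lambda>t x. (f (x * t) - f t) / g t) k at_top"
proof -
  obtain T0 where T0: "T0 > 0" "\<And>T. T \<ge> T0 \<Longrightarrow> (\<lambda>t. indicator {T..} t * f t) \<in> borel_measurable lebesgue"
    by (rule measurable_near_topE[OF meas]) blast
  \<comment> \<open>Cutting \<open>f\<close> off below \<open>T0\<close> makes it measurable on the
    whole line; for t \<ge> \<open>T0\<close> and y \<ge> 1 the cut is invisible.\<close>
  define f' where "f' t = indicator {T0..} t * f t" for t
  have f'_meas: "f' \<in> borel_measurable lebesgue"
    using T0(2)[of T0] unfolding f'_def by simp
  have f'_scale: "(\<lambda>y. f' (y * t)) \<in> borel_measurable lebesgue" for t
    using measurable_compose[OF lebesgue_measurable_scaling[of t] f'_meas]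
    by (simp add: mult.commute)
  define k' where "k' y = indicator {1..2*X} y * k y" for y
  have k'_meas: "k' \<in> borel_measurable lebesgue"
  proof -
    have "continuous_on {1..2*X} k"
      by (rule continuous_on_subset[OF k]) auto
    then have "(\<lambda>y. indicator {1..2*X} y *\<^sub>R k y) \<in> borel_measurable borel"
      by (intro borel_measurable_continuous_on_indicator) auto
    then show ?thesis
      unfolding k'_def by (simp add: measurable_completion)
  qed
  define \<psi> where "\<psi> t y = (f' (y * t) - f' t) / g t - k' y" for t y
  \<comment> \<open>The product x v ranges over [1, 2 X] for x in [1, X] and v in [1, 2]. Truncation
    at 1 supplies an integrable majorant without any a priori bound on \<open>f\<close>.\<close>
  define \<phi> where "\<phi> t y = indicator {1..2*X} y * min 1 \<bar>\<psi> t y\<bar>" for t y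
  have \<phi>_meas: "\<phi> t \<in> borel_measurable lebesgue" for t
    unfolding \<phi>_def \<psi>_def
    by (intro borel_measurable_times borel_measurable_min borel_measurable_const
        borel_measurable_abs borel_measurable_diff borel_measurable_divide f'_scale k'_meas
        borel_measurable_indicator) auto
  have dom: "integrable lebesgue (indicator {1..2*X} :: real \<Rightarrow> real)"
    by (rule integrable_real_indicator) (auto simp: emeasure_lborel_Icc_eq)
  have \<phi>_nonneg: "0 \<le> \<phi> t y" and \<phi>_le: "\<phi> t y \<le> indicator {1..2*X} y" for t y
    unfolding \<phi>_def by (auto simp: indicator_def)
  have \<phi>_int: "integrable lebesgue (\<phi> t)" for t
    by (rule Bochner_Integration.integrable_bound[OF dom \<phi>_meas])
       (use \<phi>_nonneg \<phi>_le in \<open>auto intro!: AE_I2 simp: order_trans\<close>)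
  have \<phi>_lim: "((\<lambda>t. \<phi> t y) \<longlongrightarrow> 0) at_top" for y
  proof (cases "y \<in> {1..2*X}")
    case True
    have "((\<lambda>t. (f (y * t) - f t) / g t - k y) \<longlongrightarrow> k y - k y) at_top"
      using True by (intro tendsto_intros lim) auto
    then have "((\<lambda>t. \<psi> t y) \<longlongrightarrow> k y - k y) at_top"
    proof (rule Lim_transform_eventually)
      show "\<forall>\<^sub>F t in at_top. (f (y * t) - f t) / g t - k y = \<psi> t y"
        using eventually_ge_at_top[of T0]
      proof eventually_elim
        case (elim t)
        have "1 * t \<le> y * t"
          using True elim T0(1) by (intro mult_right_mono) auto
        then show ?case
          using True elim by (simp add: \<psi>_def f'_def k'_def)
      qed
    qed
    then have "((\<lambda>t. min 1 \<bar>\<psi> t y\<bar>) \<longlongrightarrow> min 1 \<bar>0\<bar>) at_top"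
      by (intro tendsto_intros) simp_all
    then show ?thesis
      using True by (simp add: \<phi>_def)
  next
    case False
    then show ?thesis by (simp add: \<phi>_def)
  qed
  define M where "M t = (\<integral>y. \<phi> t y \<partial>lebesgue)" for t
  have M_lim: "(M \<longlongrightarrow> 0) at_top"
  proof -
    have "((\<lambda>t. integral\<^sup>L lebesgue (\<phi> t)) \<longlongrightarrow> integral\<^sup>L lebesgue (\<lambda>_::real. 0 :: real)) at_top"
    proof (rule integral_dominated_convergence_at_top[where w = "indicator {1..2*X}"])
      show "\<forall>\<^sub>F t in at_top. AE y in lebesgue. norm (\<phi> t y) \<le> indicator {1..2*X} y"
        using \<phi>_nonneg \<phi>_le by (auto intro!: AE_I2 always_eventually)
    qed (use \<phi>_lim \<phi>_meas dom in auto)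
    then show ?thesis by (simp add: M_def[abs_def])
  qed
  obtain K where K: "K > 0" "\<And>v. v \<in> {1..2} \<Longrightarrow> \<bar>k v\<bar> \<le> K"
  proof -
    have "compact (k ` {1..2})"
      by (intro compact_continuous_image continuous_on_subset[OF k]) auto
    then have "bounded (k ` {1..2})"
      by (rule compact_imp_bounded)
    then show thesis
      using that unfolding bounded_pos by (auto simp: image_iff)
  qed
  have C: "C \<ge> 0"
    using Abd[of 1] X by auto
  show ?thesis
    unfolding uniform_limit_iff
  proof (intro allI impI)
    fix e :: real assume e: "e > 0"
    \<comment> \<open>The final error is below d + (C + 1) d + d K. Moreover d \<le> 1 ensures that
      a truncated error below \<open>d\<close> is the actual error.\<close>
    define d where "d = min 1 (e / (2 + C + K))"
    have d: "d > 0" "d \<le> 1" "d * (2 + C + K) \<le> e"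
    proof -
      have pos: "2 + C + K > 0" using C K(1) by simp
      show "d > 0" "d \<le> 1" using e pos by (auto simp: d_def)
      have "d \<le> e / (2 + C + K)" by (simp add: d_def)
      then show "d * (2 + C + K) \<le> e" using pos by (simp add: pos_le_divide_eq)
    qed
    obtain T where T: "T \<ge> T0" "\<And>t. t \<ge> T \<Longrightarrow> M t < d / 2" "\<And>t. t \<ge> T \<Longrightarrow> g t \<noteq> 0"
      "\<And>t x. t \<ge> T \<Longrightarrow> x \<in> {1..X} \<Longrightarrow> \<bar>g (x * t) / g t - A x\<bar> < d"
    proof -
      have "\<forall>\<^sub>F t in at_top. t \<ge> T0 \<and> M t < d / 2 \<and> g t \<noteq> 0 \<and> (\<forall>x\<in>{1..X}. dist (g (x * t) / g t) (A x) < d)"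
        using uniform_limitD[OF A d(1)] order_tendstoD(2)[OF M_lim, of "d / 2"] d(1)
        by (intro eventually_conj g eventually_ge_at_top) auto
      then show thesis
        using that unfolding eventually_at_top_linorder dist_real_def by (meson order_refl)
    qed
    show "\<forall>\<^sub>F t in at_top. \<forall>x\<in>{1..X}. dist ((f (x * t) - f t) / g t) (k x) < e"
      using eventually_ge_at_top[of T]
    proof (eventually_elim, intro ballI)
      fix t x :: real assume t: "t \<ge> T" and x: "x \<in> {1..X}"
      have t_pos: "t > 0" using t T(1) T0(1) by simp
      have xt: "x * t \<ge> t"
        using mult_right_mono[of 1 x t] x t_pos by simp
      \<comment> \<open>If no \<open>v\<close> worked, integration over [1, 2] would give d \<le> M
        t + M (x t), although both are below d / 2. The substitution y = x v only costs a factor 1 /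
        x \<le> 1.\<close>
      have "\<exists>v\<in>{1..2}. \<phi> t (x * v) + \<phi> (x * t) v < d"
      proof (rule ccontr)
        assume "\<not> ?thesis"
        then have ge: "d \<le> \<phi> t (x * v) + \<phi> (x * t) v" if "v \<in> {1..2}" for v
          using that by force
        have int1: "integrable lebesgue (\<lambda>v. \<phi> t (x * v))"
          using lebesgue_integrable_real_affine_iff[of x "\<phi> t" 0] x \<phi>_int by simp
        have "d = (\<integral>v. d * indicator {1..2::real} v \<partial>lebesgue)"
          by (simp add: emeasure_lborel_Icc_eq)
        also have "\<dots> \<le> (\<integral>v. \<phi> t (x * v) + \<phi> (x * t) v \<partial>lebesgue)"
        proof (rule integral_mono)
          show "integrable lebesgue (\<lambda>v. d * indicator {1..2::real} v :: real)"
            by (intro integrable_mult_right integrable_real_indicator) (auto simp: emeasure_lborel_Icc_eq)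
          show "integrable lebesgue (\<lambda>v. \<phi> t (x * v) + \<phi> (x * t) v)"
            by (intro Bochner_Integration.integrable_add int1 \<phi>_int)
          show "d * indicator {1..2} v \<le> \<phi> t (x * v) + \<phi> (x * t) v" for v
            using ge[of v] \<phi>_nonneg[of t "x * v"] \<phi>_nonneg[of "x * t" v] by (auto simp: indicator_def)
        qed
        also have "\<dots> = (\<integral>v. \<phi> t (x * v) \<partial>lebesgue) + M (x * t)"
          by (simp add: int1 \<phi>_int M_def)
        also have "M t = x * (\<integral>v. \<phi> t (x * v) \<partial>lebesgue)"
          using lebesgue_integral_real_affine[of x "\<phi> t" 0] x by (simp add: M_def)
        then have "(\<integral>v. \<phi> t (x * v) \<partial>lebesgue) \<le> M t"
          using x mult_right_mono[of 1 x "\<integral>v. \<phi> t (x * v) \<partial>lebesgue"]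
          by (simp add: \<phi>_nonneg)
        finally show False
          using T(2)[OF t] T(2)[of "x * t"] t xt by simp
      qed
      then obtain v where v: "v \<in> {1..2}" "\<phi> t (x * v) + \<phi> (x * t) v < d" by blast
      have xv: "1 \<le> x * v" "x * v \<le> 2 * X"
        using x v(1) mult_mono[of 1 x 1 v] mult_mono[of x X v 2] by auto
      have "\<phi> t (x * v) < d" "\<phi> (x * t) v < d"
        using v(2) \<phi>_nonneg[of t "x * v"] \<phi>_nonneg[of "x * t" v] by linarith+
      then have \<psi>_lt: "\<bar>\<psi> t (x * v)\<bar> < d" "\<bar>\<psi> (x * t) v\<bar> < d"
        using xv v(1) X d(2) by (auto simp: \<phi>_def min_def split: if_splits)
      have gt: "g t \<noteq> 0" "g (x * t) \<noteq> 0"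
        using T(3)[OF t] T(3)[of "x * t"] t xt by auto
      have xvt: "x * v * t \<ge> T0" "v * (x * t) \<ge> T0" "x * t \<ge> T0" "t \<ge> T0"
      proof -
        have "x * v * t \<ge> t"
          using xv mult_right_mono[of 1 "x * v" t] t_pos by simp
        then show "x * v * t \<ge> T0" "v * (x * t) \<ge> T0"
          using t T(1) by (simp_all add: mult_ac)
      qed (use t T(1) xt in simp_all)
      define q where "q = g (x * t) / g t"
      have q: "\<bar>q - A x\<bar> < d"
        using T(4)[OF t x] by (simp add: q_def)
      have \<psi>1: "\<psi> t (x * v) = (f (x * v * t) - f t) / g t - k (x * v)"
        using xv xvt by (simp add: \<psi>_def f'_def k'_def)
      have \<psi>2: "q * \<psi> (x * t) v = (f (x * v * t) - f (x * t)) / g t - q * k v"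
        using v(1) X xvt gt
        by (simp add: \<psi>_def f'_def k'_def q_def algebra_simps diff_divide_distrib)
      have "(f (x * t) - f t) / g t - k x = \<psi> t (x * v) - q * \<psi> (x * t) v - (q - A x) * k v"
        using cocycle[of x v] x v(1) unfolding \<psi>1 \<psi>2
        by (simp add: algebra_simps diff_divide_distrib)
      also have "\<bar>\<dots>\<bar> \<le> \<bar>\<psi> t (x * v)\<bar> + \<bar>q\<bar> * \<bar>\<psi> (x * t) v\<bar> + \<bar>q - A x\<bar> * \<bar>k v\<bar>"
        unfolding abs_mult[symmetric] by linarith
      also have "\<dots> < d + (C + 1) * d + d * K"
      proof -
        have "\<bar>q\<bar> \<le> C + 1"
          using q Abd[OF x] d(2) by linarith
        then have "\<bar>q\<bar> * \<bar>\<psi> (x * t) v\<bar> \<le> (C + 1) * d"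
          using \<psi>_lt(2) C by (intro mult_mono) auto
        moreover have "\<bar>q - A x\<bar> * \<bar>k v\<bar> \<le> d * K"
          using q K(2)[OF v(1)] K(1) d(1) by (intro mult_mono) auto
        ultimately show ?thesis using \<psi>_lt(1) by linarith
      qed
      also have "\<dots> \<le> e"
        using d(3) by (simp add: algebra_simps)
      finally show "dist ((f (x * t) - f t) / g t) (k x) < e"
        by (simp add: dist_real_def)
    qed
  qed
qed

section \<open>The integral of a power and asymptotic constancy\<close>

text \<open>These functions serve twice: as the factor h(x) in scalar increments and, as functions
  of t, as the power terms of the representation.\<close>

definition powint :: "real \<Rightarrow> real \<Rightarrow> real" where
  "powint b x = (if b = 0 then ln x else (x powr b - 1) / b)"

lemma powint_1 [simp]: "powint b 1 = 0"
  by (simp add: powint_def)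

lemma powr_eq_powint: "x > 0 \<Longrightarrow> x powr b = 1 + b * powint b x"
  by (simp add: powint_def)

text \<open>Substitute u = x w in the part of the integral from x to x y. This is the cocycle
  relation needed for uniform convergence; read with x as the large variable, it gives the
  increments of \<open>powint b\<close> itself.\<close>

lemma powint_mult:
  assumes "x > 0" "y > 0"
  shows "powint b (x * y) = powint b x + x powr b * powint b y"
  using assms by (simp add: powint_def ln_mult powr_mult field_simps)

lemma powint_has_real_derivative:
  assumes "x > 0"
  shows "(powint b has_real_derivative x powr (b - 1)) (at x within S)"
proof -
  have "((\<lambda>x. if b = 0 then ln x else (x powr b - 1) / b) has_real_derivative x powr (b - 1)) (at x)"
  proof (cases "b = 0")
    case True
    then show ?thesis
      using assms by (auto intro!: derivative_eq_intros simp: powr_minus powr_one inverse_eq_divide)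
  next
    case False
    then show ?thesis
      using assms by (auto intro!: derivative_eq_intros)
  qed
  then show ?thesis
    unfolding powint_def[abs_def] by (rule has_field_derivative_at_within)
qed

lemma continuous_on_powint [continuous_intros]:
  assumes "continuous_on S f" "\<And>x. x \<in> S \<Longrightarrow> f x > 0"
  shows "continuous_on S (\<lambda>x. powint b (f x))"
  unfolding powint_def by (cases "b = 0") (use assms in \<open>auto intro!: continuous_intros simp: less_imp_neq[symmetric]\<close>)

lemma powint_pos:
  assumes "x > 1"
  shows "powint b x > 0"
proof -
  consider "b = 0" | "b > 0" | "b < 0" by linarith
  then show ?thesis
  proof cases
    case 3
    then have "x powr b < 1" using assms by (simp add: powr_less_one)
    then show ?thesis using 3 by (simp add: powint_def divide_neg_neg)
  qed (use assms in \<open>auto simp: powint_def\<close>)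
qed

lemma powint_nonneg: "x \<ge> 1 \<Longrightarrow> powint b x \<ge> 0"
  using powint_pos[of x b] by (cases "x = 1") auto

text \<open>The identity comes from integrating (1 + b) \<open>powint b x\<close> + 1, the
  derivative of x \<open>powint b x\<close>. Its left side arises when an average is differentiated;
  its right side is the integral of x^b over [1, 2], the factor by which averaging multiplies the
  constant of the increments. It becomes a divisor later, hence the positivity.\<close>

lemma powint_mean_identity:
  fixes b :: real
  defines "H \<equiv> integral {1..2} (powint b)"
  shows "2 * powint b 2 - H = 1 + b * H" and "1 + b * H > 0"
proof -
  have cont: "continuous_on {1..2} (powint b)"
    by (intro continuous_intros) auto
  have "((\<lambda>x. (1 + b) * powint b x + 1) has_integral 2 * powint b 2 - 1 * powint b 1) {1..2}"
  proof (rule fundamental_theorem_of_calculus)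
    fix x :: real assume x: "x \<in> {1..2}"
    have "((\<lambda>x. x * powint b x) has_real_derivative 1 * powint b x + x powr (b - 1) * x) (at x within {1..2})"
      by (intro DERIV_mult powint_has_real_derivative) (use x in \<open>auto intro!: derivative_eq_intros\<close>)
    also have "x powr (b - 1) * x = x powr b"
      using x powr_add[of x "b - 1" 1] by simp
    also have "1 * powint b x + x powr b = (1 + b) * powint b x + 1"
      using powr_eq_powint[of x b] x by (simp add: algebra_simps)
    finally show "((\<lambda>x. x * powint b x) has_vector_derivative (1 + b) * powint b x + 1) (at x within {1..2})"
      by (simp add: has_real_derivative_iff_has_vector_derivative)
  qed simp
  moreover have "((\<lambda>x. (1 + b) * powint b x + 1) has_integral (1 + b) * H + 1) {1..2}"
  proof (intro has_integral_add has_integral_mult_right)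
    show "(powint b has_integral H) {1..2}"
      unfolding H_def using integrable_continuous_real[OF cont] by (rule integrable_integral)
    show "((\<lambda>_. 1) has_integral (1 :: real)) {1..2::real}"
      using has_integral_const_real[of "1 :: real" 1 2] by simp
  qed
  ultimately have "2 * powint b 2 - 1 * powint b 1 = (1 + b) * H + 1"
    by (rule has_integral_unique)
  then show eq: "2 * powint b 2 - H = 1 + b * H"
    by (simp add: algebra_simps)
  have "H \<le> integral {1..2::real} (\<lambda>_. powint b 2)"
    unfolding H_def
  proof (rule integral_le)
    fix x :: real assume x: "x \<in> {1..2}"
    have "powint b 2 = powint b x + x powr b * powint b (2 / x)"
      using powint_mult[of x "2 / x" b] x by simp
    then show "powint b x \<le> powint b 2"
      using powint_nonneg[of "2 / x" b] x by simp
  qed (use integrable_continuous_real[OF cont] in auto)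
  then have "H \<le> powint b 2" by simp
  then show "1 + b * H > 0"
    using eq powint_pos[of 2 b] by linarith
qed

section \<open>Oriented Lebesgue integrals expressed through gauge integrals and primitives\<close>

lemma interval_lebesgue_integrable_iff_absolutely_integrable:
  fixes f :: "real \<Rightarrow> real"
  assumes "a \<le> b"
  shows "interval_lebesgue_integrable lebesgue (ereal a) (ereal b) f \<longleftrightarrow> f absolutely_integrable_on {a..b}"
  unfolding interval_lebesgue_integrable_def einterval_eq using assms
  by (simp add: absolutely_integrable_on_Icc_iff_Ioo)

lemma interval_lebesgue_integral_eq_HK:
  fixes f :: "real \<Rightarrow> real"
  assumes "a \<le> b" "f absolutely_integrable_on {a..b}"
  shows "(LINT x=ereal a..ereal b|lebesgue. f x) = integral {a..b} f"
proof -
  have "(LINT x=ereal a..ereal b|lebesgue. f x) = (LINT x:{a<..<b}|lebesgue. f x)"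
    unfolding interval_lebesgue_integral_def einterval_eq using assms(1) by simp
  also have "\<dots> = integral {a<..<b} f"
    using assms(2) by (intro set_lebesgue_integral_eq_integral) (simp add: absolutely_integrable_on_Icc_iff_Ioo)
  finally show ?thesis
    by (simp add: integral_open_interval_real)
qed

lemma interval_lebesgue_integral_FTC:
  fixes f F :: "real \<Rightarrow> real"
  assumes cont: "continuous_on {min a b..max a b} f"
    and deriv: "\<And>x. x \<in> {min a b..max a b} \<Longrightarrow> (F has_real_derivative f x) (at x)"
  shows "(LINT x=ereal a..ereal b|lebesgue. f x) = F b - F a"
proof -
  have *: "(LINT x=ereal u..ereal v|lebesgue. f x) = F v - F u"
    if "u \<le> v" "{u..v} = {min a b..max a b}" for u v
  proof -
    have "(f has_integral F v - F u) {u..v}"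
      using that deriv
      by (intro fundamental_theorem_of_calculus)
         (auto simp: has_real_derivative_iff_has_vector_derivative[symmetric] intro: has_field_derivative_at_within)
    moreover have "f absolutely_integrable_on {u..v}"
      using cont that by (intro absolutely_integrable_continuous_real) simp
    ultimately show ?thesis
      using interval_lebesgue_integral_eq_HK[OF that(1)] by (simp add: integral_unique)
  qed
  show ?thesis
  proof (cases "a \<le> b")
    case True
    then show ?thesis using *[of a b] by (simp add: min_def max_def)
  next
    case False
    then have "(LINT x=ereal a..ereal b|lebesgue. f x) = - (LINT x=ereal b..ereal a|lebesgue. f x)"
      by (subst interval_lebesgue_integral_gt_eq) (auto simp: interval_lebesgue_integral_def)
    then show ?thesis using *[of b a] False by (simp add: min_def max_def)
  qed
qed

lemma interval_lebesgue_integral_powr: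
  assumes "x > 0"
  shows "(LINT y=ereal 1..ereal x|lebesgue. (y powr (b - 1))) = powint b x"
proof -
  have "(LINT y=ereal 1..ereal x|lebesgue. (y powr (b - 1))) = powint b x - powint b 1"
    using assms
    by (intro interval_lebesgue_integral_FTC powint_has_real_derivative continuous_intros) (auto simp: min_def split: if_splits)
  then show ?thesis by simp
qed

text \<open>Along t, 2 t, 4 t, ... the increments are dominated by a geometric series whose sum is a
  small multiple of |\<gamma> t|. Hence \<phi> (2^n t) converges to some L t with \<phi> t - L t =
  o(\<gamma> t), and comparing two starting points shows that L is constant.\<close>

lemma limit_constant_of_increments:
  fixes \<phi> \<gamma> :: "real \<Rightarrow> real" and r :: real
  assumes nz: "\<forall>\<^sub>F t in at_top. \<gamma> t \<noteq> 0"
    and ratio: "((\<lambda>t. \<gamma> (2 * t) / \<gamma> t) \<longlongrightarrow> r) at_top" "\<bar>r\<bar> < 1"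
    and incr: "\<And>x. x \<ge> 1 \<Longrightarrow> (\<lambda>t. \<phi> (x * t) - \<phi> t) \<in> o[at_top](\<gamma>)"
  shows "\<exists>C. (\<lambda>t. \<phi> t - C) \<in> o[at_top](\<gamma>)"
proof -
  obtain q where q: "\<bar>r\<bar> < q" "q < 1" using dense[OF ratio(2)] by blast
  have q0: "q > 0" using q(1) by linarith
  have "\<forall>\<^sub>F t in at_top. \<bar>\<gamma> (2 * t) / \<gamma> t\<bar> < q"
    using order_tendstoD(2)[OF tendsto_rabs[OF ratio(1)] q(1)] .
  then have "\<forall>\<^sub>F t in at_top. \<bar>\<gamma> (2 * t)\<bar> \<le> q * \<bar>\<gamma> t\<bar>"
    using nz by eventually_elim (simp add: abs_divide pos_divide_less_eq)
  then obtain T0 where T0: "\<And>t. t \<ge> T0 \<Longrightarrow> \<bar>\<gamma> (2 * t)\<bar> \<le> q * \<bar>\<gamma> t\<bar>"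
    unfolding eventually_at_top_linorder by blast
  have pow_ge: "2 ^ n * t \<ge> t" if "t \<ge> (1::real)" for n t
    using mult_right_mono[of 1 "2 ^ n" t] that by simp
  have geom: "\<bar>\<gamma> (2 ^ n * t)\<bar> \<le> q ^ n * \<bar>\<gamma> t\<bar>" if "t \<ge> T0" "t \<ge> 1" for n t
  proof (induction n)
    case (Suc n)
    have "\<bar>\<gamma> (2 ^ Suc n * t)\<bar> \<le> q * \<bar>\<gamma> (2 ^ n * t)\<bar>"
      using T0[of "2 ^ n * t"] order_trans[OF that(1) pow_ge[OF that(2), of n]] by (simp add: mult.assoc)
    also have "\<dots> \<le> q * (q ^ n * \<bar>\<gamma> t\<bar>)"
      using Suc q0 by (intro mult_left_mono) auto
    finally show ?case by (simp add: mult.assoc)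
  qed simp
  define d where "d t n = \<phi> (2 ^ Suc n * t) - \<phi> (2 ^ n * t)" for t n
  have d_bound: "summable (d t) \<and> \<bar>suminf (d t)\<bar> \<le> e * \<bar>\<gamma> t\<bar> / (1 - q)"
    if "t \<ge> T0" "t \<ge> 1" "e > 0" "\<And>u. u \<ge> t \<Longrightarrow> \<bar>\<phi> (2 * u) - \<phi> u\<bar> \<le> e * \<bar>\<gamma> u\<bar>" for t e
  proof -
    have le: "norm (d t n) \<le> (e * \<bar>\<gamma> t\<bar>) * q ^ n" for n
    proof -
      have "\<bar>d t n\<bar> \<le> e * \<bar>\<gamma> (2 ^ n * t)\<bar>"
        using that(4)[OF pow_ge[OF that(2)], of n] by (simp add: d_def mult.assoc)
      also have "\<dots> \<le> e * (q ^ n * \<bar>\<gamma> t\<bar>)"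
        using geom that by (intro mult_left_mono) auto
      finally show ?thesis by (simp add: mult_ac)
    qed
    have sums: "(\<lambda>n. (e * \<bar>\<gamma> t\<bar>) * q ^ n) sums (e * \<bar>\<gamma> t\<bar> * (1 / (1 - q)))"
      using q q0 by (intro sums_mult geometric_sums) simp
    have "summable (d t)"
      by (rule summable_comparison_test'[OF sums_summable[OF sums]]) (rule le)
    moreover have "norm (suminf (d t)) \<le> e * \<bar>\<gamma> t\<bar> * (1 / (1 - q))"
      using norm_suminf_le[OF le sums_summable[OF sums]] sums_unique[OF sums] by simp
    ultimately show ?thesis by simp
  qed
  \<comment> \<open>The series telescopes, so this is the limit of \<phi> (2^n t).\<close>
  define L where "L t = \<phi> t + suminf (d t)" for t
  have small: "\<forall>\<^sub>F t in at_top. \<forall>u\<ge>t. \<bar>\<phi> (2 * u) - \<phi> u\<bar> \<le> e * \<bar>\<gamma> u\<bar>" if "e > 0" for e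
  proof -
    have "(\<lambda>t. \<phi> (2 * t) - \<phi> t) \<in> o[at_top](\<gamma>)"
      by (rule incr) simp
    from landau_o.smallD[OF this that] obtain T where "\<And>u. u \<ge> T \<Longrightarrow> \<bar>\<phi> (2 * u) - \<phi> u\<bar> \<le> e * \<bar>\<gamma> u\<bar>"
      by (auto simp: eventually_at_top_linorder)
    then show ?thesis
      by (auto simp: eventually_at_top_linorder intro!: exI[of _ T])
  qed
  obtain T1 where T1: "T1 \<ge> T0" "T1 \<ge> 1" "\<And>u. u \<ge> T1 \<Longrightarrow> \<bar>\<phi> (2 * u) - \<phi> u\<bar> \<le> 1 * \<bar>\<gamma> u\<bar>"
  proof -
    have "\<forall>\<^sub>F t in at_top. t \<ge> T0 \<and> t \<ge> 1 \<and> (\<forall>u\<ge>t. \<bar>\<phi> (2 * u) - \<phi> u\<bar> \<le> 1 * \<bar>\<gamma> u\<bar>)"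
      by (intro eventually_conj small eventually_ge_at_top) simp
    then show thesis using that unfolding eventually_at_top_linorder by blast
  qed
  have L_lim: "(\<lambda>n. \<phi> (2 ^ n * t)) \<longlonglongrightarrow> L t" if "t \<ge> T1" for t
  proof -
    have "summable (d t)"
      using d_bound[of t 1] T1 that by auto
    then have "(\<lambda>n. \<phi> t + (\<Sum>i<n. d t i)) \<longlonglongrightarrow> L t"
      unfolding L_def by (intro tendsto_intros summable_LIMSEQ)
    moreover have "\<phi> t + (\<Sum>i<n. d t i) = \<phi> (2 ^ n * t)" for n
      unfolding d_def using sum_lessThan_telescope[of "\<lambda>n. \<phi> (2 ^ n * t)" n] by simp
    ultimately show ?thesis by simp
  qed
  \<comment> \<open>For the fixed ratio x = t / \<open>T1\<close> the difference of \<phi> at 2^n t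
    and 2^n \<open>T1\<close> is o(\<gamma> (2^n \<open>T1\<close>)), and \<gamma> tends to 0 along
    that sequence.\<close>
  have L_const: "L t = L T1" if "t \<ge> T1" for t
  proof -
    define x where "x = t / T1"
    have x: "x \<ge> 1" "t = x * T1" using that T1(2) by (auto simp: x_def)
    have "filterlim (\<lambda>n. 2 ^ n * T1 :: real) at_top sequentially"
      using T1(2)
      by (intro filterlim_at_top_mult_tendsto_pos[where c = T1] tendsto_const
          filterlim_at_infinity_imp_filterlim_at_top filterlim_realpow_sequentially_gt1) auto
    then have o: "(\<lambda>n. \<phi> (x * (2 ^ n * T1)) - \<phi> (2 ^ n * T1)) \<in> o(\<lambda>n. \<gamma> (2 ^ n * T1))"
      using landau_o.small.compose[OF incr[OF x(1)]] by blast
    have \<gamma>0: "(\<lambda>n. \<gamma> (2 ^ n * T1)) \<longlonglongrightarrow> 0"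
    proof (rule Lim_null_comparison)
      show "\<forall>\<^sub>F n in sequentially. norm (\<gamma> (2 ^ n * T1)) \<le> q ^ n * \<bar>\<gamma> T1\<bar>"
        using geom[OF T1(1,2)] by simp
      show "(\<lambda>n. q ^ n * \<bar>\<gamma> T1\<bar>) \<longlonglongrightarrow> 0"
        using q q0 by (intro tendsto_mult_left_zero LIMSEQ_power_zero) simp
    qed
    have "(\<lambda>n. \<phi> (x * (2 ^ n * T1)) - \<phi> (2 ^ n * T1)) \<longlonglongrightarrow> 0"
    proof (rule Lim_null_comparison)
      show "\<forall>\<^sub>F n in sequentially. norm (\<phi> (x * (2 ^ n * T1)) - \<phi> (2 ^ n * T1)) \<le> \<bar>\<gamma> (2 ^ n * T1)\<bar>"
        using landau_o.smallD[OF o, of 1] by simp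
      show "(\<lambda>n. \<bar>\<gamma> (2 ^ n * T1)\<bar>) \<longlonglongrightarrow> 0"
        using \<gamma>0 by (rule tendsto_rabs_zero)
    qed
    moreover have "(\<lambda>n. \<phi> (2 ^ n * t) - \<phi> (2 ^ n * T1)) \<longlonglongrightarrow> L t - L T1"
      using that by (intro tendsto_intros L_lim) auto
    ultimately show ?thesis
      using LIMSEQ_unique by (fastforce simp: x(2) mult_ac)
  qed
  have "(\<lambda>t. \<phi> t - L T1) \<in> o[at_top](\<gamma>)"
  proof (rule landau_o.smallI)
    fix e :: real assume e: "e > 0"
    \<comment> \<open>Cancels the factor 1 / (1 - q) contributed by the geometric series.\<close>
    define e' where "e' = e * (1 - q)"
    have e': "e' > 0" using e q by (simp add: e'_def)
    show "\<forall>\<^sub>F t in at_top. norm (\<phi> t - L T1) \<le> e * norm (\<gamma> t)"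
      using small[OF e'] eventually_ge_at_top[of T1]
    proof eventually_elim
      case (elim t)
      have "\<bar>suminf (d t)\<bar> \<le> e' * \<bar>\<gamma> t\<bar> / (1 - q)"
        using d_bound[of t e'] elim T1 e' by auto
      also have "\<dots> = e * \<bar>\<gamma> t\<bar>" using q by (simp add: e'_def)
      also have "suminf (d t) = - (\<phi> t - L T1)"
        using L_const[OF elim(2)] by (simp add: L_def)
      finally show ?case by simp
    qed
  qed
  then show ?thesis by blast
qed

section \<open>Averages over dyadic intervals\<close>

text \<open>Equal to the mean of f (x t) over x in [1, 2], which is where uniform increments can be
  inserted; the form with moving endpoints is the one that can be differentiated.\<close>

definition avg :: "(real \<Rightarrow> real) \<Rightarrow> real \<Rightarrow> real" where
  "avg f t = integral {t..2 * t} f / t"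

lemma avg_eq_diff:
  assumes "\<And>t. f integrable_on {T..t}" "T > 0" "t \<ge> T"
  shows "avg f t = (integral {T..2 * t} f - integral {T..t} f) / t"
proof -
  have "integral {T..t} f + integral {t..2*t} f = integral {T..2*t} f"
    using assms by (intro Henstock_Kurzweil_Integration.integral_combine) auto
  then show ?thesis by (simp add: avg_def)
qed

lemma continuous_on_avg:
  assumes "\<And>t. f integrable_on {T..t}" "T > 0"
  shows "continuous_on {T..} (avg f)"
proof -
  have I: "continuous_on {T..} (\<lambda>t. integral {T..t} f)"
    unfolding continuous_on_eq_continuous_within
  proof
    fix t assume t: "t \<in> {T..}"
    \<comment> \<open>Continuity at \<open>t\<close> is local, so a compact interval reaching beyond
      \<open>t\<close> suffices.\<close>
    have "continuous_on {T..t+1} (\<lambda>t. integral {T..t} f)"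
      by (rule indefinite_integral_continuous_1) (rule assms)
    then have "continuous (at t within {T..t+1}) (\<lambda>t. integral {T..t} f)"
      using t by (auto simp: continuous_on_eq_continuous_within)
    moreover have "at t within {T..t+1} = at t within {T..}"
      by (rule at_within_nhd[of _ "{..<t+1}"]) auto
    ultimately show "continuous (at t within {T..}) (\<lambda>t. integral {T..t} f)" by simp
  qed
  have "continuous_on {T..} (\<lambda>t. (integral {T..2 * t} f - integral {T..t} f) / t)"
    by (intro continuous_intros I continuous_on_compose2[OF I]) (use assms(2) in auto)
  then show ?thesis
    by (rule continuous_on_cong[THEN iffD1, rotated 2]) (auto simp: avg_eq_diff[OF assms])
qed

lemma avg_has_real_derivative:
  assumes cont: "continuous_on {T..} f" and T: "T > 0" "t > T"
  shows "(avg f has_real_derivative (2 * f (2 * t) - f t - avg f t) / t) (at t)"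
proof -
  have int: "f integrable_on {T..s}" for s
    by (intro integrable_continuous_real continuous_on_subset[OF cont]) auto
  have I: "((\<lambda>s. integral {T..s} f) has_real_derivative f u) (at u)" if "u > T" for u
  proof -
    have "((\<lambda>s. integral {T..s} f) has_real_derivative f u) (at u within {T..u+1})"
      using that by (intro integral_has_real_derivative continuous_on_subset[OF cont]) auto
    moreover have "at u within {T..u+1} = at u"
      using that by (intro at_within_interior) simp
    ultimately show ?thesis by simp
  qed
  have "((\<lambda>s. integral {T..2 * s} f) has_real_derivative f (2 * t) * 2) (at t)"
    by (rule DERIV_chain2[OF I]) (use T in \<open>auto intro!: derivative_eq_intros\<close>)
  then have "((\<lambda>t. (integral {T..2 * t} f - integral {T..t} f) / t) has_real_derivative
      ((f (2 * t) * 2 - f t) * t - (integral {T..2 * t} f - integral {T..t} f) * 1) / (t * t)) (at t)"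
    using T by (intro DERIV_divide DERIV_diff I DERIV_ident) auto
  also have "((f (2 * t) * 2 - f t) * t - (integral {T..2 * t} f - integral {T..t} f) * 1) / (t * t)
      = (2 * f (2 * t) - f t - avg f t) / t"
    using T by (simp add: avg_eq_diff[OF int T(1)] field_simps)
  finally show ?thesis
  proof (rule DERIV_cong_ev[THEN iffD1, rotated 3])
    show "\<forall>\<^sub>F s in nhds t. (integral {T..2 * s} f - integral {T..s} f) / s = avg f s"
      using eventually_nhds_in_open[of "{T<..}" t] T
      by (auto elim!: eventually_mono simp: avg_eq_diff[OF int])
  qed auto
qed

section \<open>Increments relative to a regularly varying function\<close>

text \<open>The limit is stated for the signed ratio; under constant sign it is the same as the one
  for |g|.\<close>

locale rv_rate =
  fixes g :: "real \<Rightarrow> real" and b :: real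
  assumes g_meas: "measurable_near_top g"
    and g_sign: "eventually_constant_sign g"
    and g_lim: "\<And>x. x > 0 \<Longrightarrow> ((\<lambda>t. g (x * t) / g t) \<longlongrightarrow> x powr b) at_top"
begin

lemma g_nz: "\<forall>\<^sub>F t in at_top. g t \<noteq> 0"
  using g_sign unfolding eventually_constant_sign_def by (auto elim: eventually_mono)

lemma g_bigo: "x > 0 \<Longrightarrow> (\<lambda>t. g (x * t)) \<in> O[at_top](g)"
  using g_lim g_nz by (intro bigoI_tendsto) auto

lemma smallo_scale:
  assumes "r \<in> o[at_top](g)" "x > 0"
  shows "(\<lambda>t. r (x * t)) \<in> o[at_top](g)"
proof -
  have "(\<lambda>t. r (x * t)) \<in> o[at_top](\<lambda>t. g (x * t))"
    using landau_o.small.compose[OF assms(1) filterlim_scale[OF assms(2)]] .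
  then show ?thesis
    using g_bigo[OF assms(2)] landau_o.small_big_trans by blast
qed

text \<open>The increments of ln |g| tend to b ln x, so uniform convergence applies to ln |g| with
  constant rate 1. Exponentiation preserves it, since exp is uniformly continuous on bounded
  sets.\<close>

lemma g_uniform_limit:
  assumes "X \<ge> 1"
  shows "uniform_limit {1..X} (\<lambda>t x. g (x * t) / g t) (\<lambda>x. x powr b) at_top"
proof -
  obtain T where T: "T > 0" "(\<forall>t\<ge>T. g t > 0) \<or> (\<forall>t\<ge>T. g t < 0)"
  proof -
    obtain T where "(\<forall>t\<ge>T. g t > 0) \<or> (\<forall>t\<ge>T. g t < 0)"
      using g_sign unfolding eventually_constant_sign_def eventually_at_top_linorder by blast
    then have "(\<forall>t\<ge>max 1 T. g t > 0) \<or> (\<forall>t\<ge>max 1 T. g t < 0)"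
      by auto
    then show thesis
      by (intro that[of "max 1 T"]) auto
  qed
  define f where "f t = ln \<bar>g t\<bar>" for t
  have f_meas: "measurable_near_top f"
  proof -
    obtain t0 where "g \<in> borel_measurable (lebesgue_on {t0..})"
      using g_meas unfolding measurable_near_top_def by blast
    then have "f \<in> borel_measurable (lebesgue_on {t0..})"
      unfolding f_def[abs_def] by measurable
    then show ?thesis unfolding measurable_near_top_def by blast
  qed
  have ratio: "(f (x * t) - f t) / 1 = ln (g (x * t) / g t)" "g (x * t) / g t > 0"
    if "x \<ge> 1" "t \<ge> T" for x t
  proof -
    have "x * t \<ge> T" using mult_right_mono[of 1 x t] that T(1) by linarith
    then have "g (x * t) > 0 \<and> g t > 0 \<or> g (x * t) < 0 \<and> g t < 0"
      using T(2) that(2) by blast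
    then show "(f (x * t) - f t) / 1 = ln (g (x * t) / g t)" "g (x * t) / g t > 0"
      unfolding f_def using ln_div[of "g (x * t)" "g t"] ln_div[of "- g (x * t)" "- g t"]
      by (auto simp: divide_neg_neg abs_of_neg)
  qed
  have u: "uniform_limit {1..X} (\<lambda>t x. (f (x * t) - f t) / 1) (\<lambda>x. b * ln x) at_top"
  proof (rule uniform_limit_increments[where A = "\<lambda>_. 1" and C = 1])
    fix x :: real assume x: "x \<ge> 1"
    have "((\<lambda>t. ln (g (x * t) / g t)) \<longlongrightarrow> ln (x powr b)) at_top"
      using x by (intro tendsto_ln g_lim) auto
    then have "((\<lambda>t. ln (g (x * t) / g t)) \<longlongrightarrow> b * ln x) at_top"
      by (simp add: ln_powr)
    then show "((\<lambda>t. (f (x * t) - f t) / 1) \<longlongrightarrow> b * ln x) at_top"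
    proof (rule Lim_transform_eventually)
      show "\<forall>\<^sub>F t in at_top. ln (g (x * t) / g t) = (f (x * t) - f t) / 1"
        using eventually_ge_at_top[of T] by eventually_elim (use ratio x in simp)
    qed
  qed (use f_meas assms in \<open>auto intro!: continuous_intros uniform_limit_const simp: ln_mult algebra_simps\<close>)
  \<comment> \<open>The limits b ln x stay within K - 1, so approximations with error below 1 stay
    in the compact set [-K, K].\<close>
  define K where "K = \<bar>b\<bar> * ln X + 1"
  have bln: "\<bar>b * ln x\<bar> \<le> K - 1" if "x \<in> {1..X}" for x
    using that assms unfolding K_def abs_mult by (auto intro!: mult_left_mono)
  have "uniform_limit {1..X} (\<lambda>t x. exp ((f (x * t) - f t) / 1)) (\<lambda>x. exp (b * ln x)) at_top"
  proof (rule uniform_limit_compose_uniformly_continuous_on[OF u, where B = "{-K..K}"])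
    show "uniformly_continuous_on {-K..K} (exp :: real \<Rightarrow> real)"
      by (intro compact_uniformly_continuous continuous_intros) auto
    have "\<forall>\<^sub>F t in at_top. \<forall>x\<in>{1..X}. dist ((f (x * t) - f t) / 1) (b * ln x) < 1"
      by (rule uniform_limitD[OF u]) simp
    then show "\<forall>\<^sub>F t in at_top. \<forall>x\<in>{1..X}. (f (x * t) - f t) / 1 \<in> {-K..K}"
    proof (eventually_elim, intro ballI)
      fix t x assume "\<forall>x\<in>{1..X}. dist ((f (x * t) - f t) / 1) (b * ln x) < 1" and x: "x \<in> {1..X}"
      then have "\<bar>(f (x * t) - f t) / 1 - b * ln x\<bar> < 1" by (auto simp: dist_real_def)
      then show "(f (x * t) - f t) / 1 \<in> {-K..K}"
        using bln[OF x] by (simp only: atLeastAtMost_iff) linarith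
    qed
  qed auto
  then show ?thesis
  proof (rule uniform_limit_cong[THEN iffD1, rotated 2])
    show "\<forall>\<^sub>F t in at_top. \<forall>x\<in>{1..X}. exp ((f (x * t) - f t) / 1) = g (x * t) / g t"
      using eventually_ge_at_top[of T] by eventually_elim (use ratio in \<open>auto simp only: exp_ln atLeastAtMost_iff\<close>)
    show "exp (b * ln x) = x powr b" if "x \<in> {1..X}" for x
      using that by (simp add: powr_def)
  qed
qed

text \<open>The one-dimensional case of generalised regular variation, with h(x) = c
  \<open>powint b x\<close> and measurability of \<open>f\<close> kept apart.\<close>

definition incr :: "(real \<Rightarrow> real) \<Rightarrow> real \<Rightarrow> bool" where
  "incr f c \<longleftrightarrow> (\<forall>x>0. (\<lambda>t. f (x * t) - f t - c * powint b x * g t) \<in> o[at_top](g))"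

lemma incr_lincomb:
  assumes "incr f c" "incr f' c'"
  shows "incr (\<lambda>t. p * f t + q * f' t) (p * c + q * c')"
  unfolding incr_def
proof (intro allI impI)
  fix x :: real assume x: "x > 0"
  have "(\<lambda>t. p * (f (x * t) - f t - c * powint b x * g t)
           + q * (f' (x * t) - f' t - c' * powint b x * g t)) \<in> o[at_top](g)"
    using assms x unfolding incr_def by (simp add: sum_in_smallo)
  then show "(\<lambda>t. p * f (x * t) + q * f' (x * t) - (p * f t + q * f' t)
      - (p * c + q * c') * powint b x * g t) \<in> o[at_top](g)"
    by (simp add: algebra_simps)
qed

lemma incr_smallo:
  assumes "r \<in> o[at_top](g)"
  shows "incr r 0"
  unfolding incr_def using assms smallo_scale[OF assms] by (simp add: sum_in_smallo)

text \<open>Because x^b = 1 + b \<open>powint b x\<close>. Thus g is itself an admissible f, which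
  is what allows multiples of its averages to correct those of f.\<close>

lemma incr_self: "incr g b"
  unfolding incr_def
proof (intro allI impI)
  fix x :: real assume x: "x > 0"
  have "((\<lambda>t. g (x * t) / g t - x powr b) \<longlongrightarrow> x powr b - x powr b) at_top"
    by (intro tendsto_intros g_lim x)
  then have "((\<lambda>t. g (x * t) / g t - x powr b) \<longlongrightarrow> 0) at_top" by simp
  then have "((\<lambda>t. (g (x * t) - g t - b * powint b x * g t) / g t) \<longlongrightarrow> 0) at_top"
  proof (rule Lim_transform_eventually)
    show "\<forall>\<^sub>F t in at_top. g (x * t) / g t - x powr b = (g (x * t) - g t - b * powint b x * g t) / g t"
      using g_nz by eventually_elim (simp add: powr_eq_powint[OF x] field_simps)
  qed
  then show "(\<lambda>t. g (x * t) - g t - b * powint b x * g t) \<in> o[at_top](g)"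
    using g_nz by (intro smalloI_tendsto)
qed

section \<open>Uniform increments, local integrability and the effect of averaging\<close>

lemma incr_uniform_limit:
  assumes "measurable_near_top f" "incr f c" "X \<ge> 1"
  shows "uniform_limit {1..X} (\<lambda>t x. (f (x * t) - f t) / g t) (\<lambda>x. c * powint b x) at_top"
proof (rule uniform_limit_increments[OF assms(1) _ assms(3) g_nz g_uniform_limit[OF assms(3)]])
  show "continuous_on {1..} (\<lambda>x. c * powint b x)"
    by (intro continuous_intros) auto
  show "\<bar>x powr b\<bar> \<le> X powr \<bar>b\<bar>" if "x \<in> {1..X}" for x
  proof -
    have "x powr b \<le> x powr \<bar>b\<bar>" using that by (intro powr_mono) auto
    also have "\<dots> \<le> X powr \<bar>b\<bar>" using that by (intro powr_mono2) auto
    finally show ?thesis by simp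
  qed
  show "c * powint b (x * y) = c * powint b x + x powr b * (c * powint b y)" if "x \<ge> 1" "y \<ge> 1" for x y
    using that powint_mult[of x y b] by (simp add: algebra_simps)
  show "((\<lambda>t. (f (x * t) - f t) / g t) \<longlongrightarrow> c * powint b x) at_top" if "x \<ge> 1" for x
  proof -
    have "(\<lambda>t. f (x * t) - f t - c * powint b x * g t) \<in> o[at_top](g)"
      using assms(2) that unfolding incr_def by auto
    from tendsto_add[OF smalloD_tendsto[OF this] tendsto_const[of "c * powint b x"]]
    have "((\<lambda>t. (f (x * t) - f t - c * powint b x * g t) / g t + c * powint b x) \<longlongrightarrow> c * powint b x) at_top"
      by simp
    then show ?thesis
    proof (rule Lim_transform_eventually)
      show "\<forall>\<^sub>F t in at_top. (f (x * t) - f t - c * powint b x * g t) / g t + c * powint b x = (f (x * t) - f t) / g t"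
        using g_nz by eventually_elim (simp add: field_simps)
    qed
  qed
qed

lemma incr_eventually_uniform:
  assumes "measurable_near_top f" "incr f c" "X \<ge> 1" "e > 0"
  shows "\<forall>\<^sub>F t in at_top. \<forall>x\<in>{1..X}. \<bar>f (x * t) - f t - c * powint b x * g t\<bar> \<le> e * \<bar>g t\<bar>"
  using uniform_limitD[OF incr_uniform_limit[OF assms(1-3)] assms(4)] g_nz
proof (eventually_elim, intro ballI)
  fix t x assume *: "\<forall>x\<in>{1..X}. dist ((f (x * t) - f t) / g t) (c * powint b x) < e" "g t \<noteq> 0" "x \<in> {1..X}"
  have "f (x * t) - f t - c * powint b x * g t = ((f (x * t) - f t) / g t - c * powint b x) * g t"
    using *(2) by (simp add: field_simps)
  then have "\<bar>f (x * t) - f t - c * powint b x * g t\<bar> = \<bar>(f (x * t) - f t) / g t - c * powint b x\<bar> * \<bar>g t\<bar>"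
    by (simp add: abs_mult)
  also have "\<dots> \<le> e * \<bar>g t\<bar>"
    using * by (intro mult_right_mono) (auto simp: dist_real_def less_imp_le)
  finally show "\<bar>f (x * t) - f t - c * powint b x * g t\<bar> \<le> e * \<bar>g t\<bar>" .
qed

text \<open>Uniformity on [1, 2] bounds f on [t, 2 t] in terms of f t and g t. Repeated doubling
  bounds it on every [T, 2^n T], and a bounded measurable function is integrable there.\<close>

lemma incr_integrable:
  assumes "measurable_near_top f" "incr f c"
  obtains T where "T > 0" "\<And>t. f integrable_on {T..t}"
proof -
  obtain T0 where T0: "T0 > 0" "\<And>T. T \<ge> T0 \<Longrightarrow> (\<lambda>t. indicator {T..} t * f t) \<in> borel_measurable lebesgue"
    by (rule measurable_near_topE[OF assms(1)]) blast
  have "\<forall>\<^sub>F t in at_top. t \<ge> T0 \<and> (\<forall>x\<in>{1..2}. \<bar>f (x * t) - f t - c * powint b x * g t\<bar> \<le> 1 * \<bar>g t\<bar>)"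
    by (intro eventually_conj eventually_ge_at_top incr_eventually_uniform assms) auto
  then obtain T where "\<forall>t\<ge>T. t \<ge> T0 \<and> (\<forall>x\<in>{1..2}. \<bar>f (x * t) - f t - c * powint b x * g t\<bar> \<le> 1 * \<bar>g t\<bar>)"
    unfolding eventually_at_top_linorder by blast
  then have T: "T \<ge> T0" "\<And>t x. t \<ge> T \<Longrightarrow> x \<in> {1..2} \<Longrightarrow> \<bar>f (x * t) - f t - c * powint b x * g t\<bar> \<le> \<bar>g t\<bar>"
    by simp_all
  have T_pos: "T > 0" using T(1) T0(1) by simp
  have "compact (powint b ` {1..2})"
    by (intro compact_continuous_image continuous_intros) auto
  then have "bounded (powint b ` {1..2})"
    by (rule compact_imp_bounded)
  then obtain K where "\<forall>x\<in>{1..2}. \<bar>powint b x\<bar> \<le> K"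
    unfolding bounded_iff by auto
  then have K: "\<bar>powint b x\<bar> \<le> K" if "x \<in> {1..2}" for x
    using that by blast
  have step: "\<bar>f u\<bar> \<le> \<bar>f t\<bar> + (\<bar>c\<bar> * K + 1) * \<bar>g t\<bar>" if "t \<ge> T" "u \<in> {t..2*t}" for t u
  proof -
    have x: "u / t \<in> {1..2}" "u / t * t = u"
      using that T_pos by (auto simp: field_simps)
    have "\<bar>f u - f t - c * powint b (u / t) * g t\<bar> \<le> \<bar>g t\<bar>"
      using T(2)[OF that(1) x(1)] x(2) by simp
    moreover have "\<bar>c * powint b (u / t) * g t\<bar> \<le> \<bar>c\<bar> * K * \<bar>g t\<bar>"
      using K[OF x(1)] unfolding abs_mult by (intro mult_right_mono mult_left_mono) auto
    ultimately have "\<bar>f u\<bar> \<le> \<bar>f t\<bar> + \<bar>c\<bar> * K * \<bar>g t\<bar> + \<bar>g t\<bar>" by linarith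
    then show ?thesis by (simp add: algebra_simps)
  qed
  have bdd: "\<exists>M. \<forall>u\<in>{T..2 ^ n * T}. \<bar>f u\<bar> \<le> M" for n
  proof (induction n)
    case 0
    then show ?case by (auto intro!: exI[of _ "\<bar>f T\<bar>"])
  next
    case (Suc n)
    then obtain M where M: "\<And>u. u \<in> {T..2 ^ n * T} \<Longrightarrow> \<bar>f u\<bar> \<le> M" by blast
    define t where "t = 2 ^ n * T"
    have t: "t \<ge> T" using T_pos mult_right_mono[of 1 "2 ^ n" T] by (simp add: t_def)
    show ?case
    proof (intro exI ballI)
      fix u assume u: "u \<in> {T..2 ^ Suc n * T}"
      show "\<bar>f u\<bar> \<le> max M (\<bar>f t\<bar> + (\<bar>c\<bar> * K + 1) * \<bar>g t\<bar>)"
      proof (cases "u \<le> t")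
        case True
        then show ?thesis using M[of u] u by (auto simp: t_def)
      next
        case False
        then have "u \<in> {t..2*t}" using u by (simp add: t_def)
        then show ?thesis using step[OF t] by (meson max.coboundedI2)
      qed
    qed
  qed
  have "f integrable_on {T..t}" for t
  proof -
    obtain n where "t / T < 2 ^ n"
      using real_arch_pow[of 2 "t / T"] by auto
    then have "t \<le> 2 ^ n * T" using T_pos by (simp add: field_simps)
    moreover obtain M where "\<forall>u\<in>{T..2 ^ n * T}. \<bar>f u\<bar> \<le> M"
      using bdd by blast
    ultimately have M: "\<bar>f u\<bar> \<le> M" if "u \<in> {T..t}" for u
      using that by simp
    have "f \<in> borel_measurable (lebesgue_on {T..})"
      using T0(2)[OF T(1)] by (simp add: borel_measurable_restrict_space_iff)
    then have "f \<in> borel_measurable (lebesgue_on {T..t})"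
      by (rule measurable_restrict_mono) auto
    then show ?thesis
      by (rule measurable_bounded_by_integrable_imp_integrable[where g = "\<lambda>_. M"]) (use M in auto)
  qed
  with T_pos show thesis by (rule that)
qed

text \<open>The relative shift caused by averaging: a function with constant c moves by c H g, up to
  o(g).\<close>

definition H :: real where
  "H = integral {1..2} (powint b)"

text \<open>Integrate the uniform error bound for f (x t) - f t over x in [1, 2]; the interval has
  length 1, so the bound survives unchanged.\<close>

lemma avg_asymp:
  assumes "measurable_near_top f" "incr f c"
  shows "(\<lambda>t. avg f t - f t - c * H * g t) \<in> o[at_top](g)"
proof (rule landau_o.smallI)
  fix e :: real assume e: "e > 0"
  obtain T where T: "T > 0" "\<And>t. f integrable_on {T..t}"
    by (rule incr_integrable[OF assms]) (rule that)
  show "\<forall>\<^sub>F t in at_top. norm (avg f t - f t - c * H * g t) \<le> e * norm (g t)"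
    using incr_eventually_uniform[OF assms, of 2 e, OF _ e, simplified] eventually_ge_at_top[of T]
  proof eventually_elim
    case (elim t)
    have t: "t > 0" using elim(2) T(1) by simp
    have "f integrable_on {t..2*t}"
      using T(2)[of "2 * t"] by (rule integrable_subinterval_real) (use elim(2) in auto)
    then have "(f has_integral integral {t..2*t} f) {t..2*t}" by (rule integrable_integral)
    from has_integral_stretch_real[OF this, of t]
    have "((\<lambda>x. f (t * x)) has_integral (1 / \<bar>t\<bar>) *\<^sub>R integral {t..2*t} f) ((\<lambda>x. x / t) ` {t..2*t})"
      using t by simp
    moreover have "(\<lambda>x. x / t) ` {t..2*t} = {1..2}"
      using t by (auto simp: image_iff field_simps intro!: bexI[of _ "_ * t"])
    ultimately have "((\<lambda>x. f (x * t)) has_integral avg f t) {1..2}"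
      using t by (simp add: avg_def mult.commute)
    moreover have "(powint b has_integral H) {1..2}"
      unfolding H_def
      by (intro integrable_integral integrable_continuous_real continuous_intros) auto
    moreover have "((\<lambda>_. f t) has_integral f t) {1..2::real}"
      using has_integral_const_real[of "f t" 1 2] by simp
    ultimately have "((\<lambda>x. f (x * t) - f t - c * powint b x * g t) has_integral avg f t - f t - c * H * g t) {1..2}"
      by (intro has_integral_diff has_integral_mult_left has_integral_mult_right)
    then have "norm (avg f t - f t - c * H * g t) \<le> e * norm (g t) * Sigma_Algebra.measure lborel {1..2::real}"
      by (rule has_integral_bound_real[where S = "{}", rotated 2]) (use elim e in auto)
    then show ?case by simp
  qed
qed

text \<open>The average is f + c H g plus a remainder; g has constant b and the remainder constant
  0, so the constants add up to c + c H b.\<close>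

lemma incr_avg:
  assumes "measurable_near_top f" "incr f c"
  shows "incr (avg f) (c * (1 + b * H))"
proof -
  have "incr (\<lambda>t. 1 * (1 * f t + c * H * g t) + 1 * (avg f t - f t - c * H * g t)) (1 * (1 * c + c * H * b) + 1 * 0)"
    by (intro incr_lincomb incr_smallo incr_self avg_asymp assms)
  then show ?thesis by (simp add: algebra_simps)
qed

text \<open>Averaging once gives continuity, averaging a second time gives a continuous derivative,
  so that no almost everywhere differentiation is needed.\<close>

lemma avg_avg:
  assumes f: "measurable_near_top f" "incr f c"
  defines "m \<equiv> 1 + b * H"
  obtains T \<Phi>' where "T > 0" "\<And>t. t \<ge> T \<Longrightarrow> (avg (avg f) has_real_derivative \<Phi>' t) (at t)"
    "continuous_on {T..} \<Phi>'"
    "(\<lambda>t. avg (avg f) t - f t - c * H * (1 + m) * g t) \<in> o[at_top](g)"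
    "(\<lambda>t. t * \<Phi>' t - c * m\<^sup>2 * g t) \<in> o[at_top](g)"
proof -
  obtain T where T: "T > 0" "\<And>t. f integrable_on {T..t}"
    by (rule incr_integrable[OF f]) (rule that)
  have cont: "continuous_on {T..} (avg f)"
    by (rule continuous_on_avg[OF T(2,1)])
  have int: "avg f integrable_on {T..s}" for s
    by (intro integrable_continuous_real continuous_on_subset[OF cont]) auto
  have cont2: "continuous_on {T..} (avg (avg f))"
    by (rule continuous_on_avg[OF int T(1)])
  have meas: "measurable_near_top (avg f)"
    by (rule measurable_near_top_continuous[OF cont])
  have incr: "incr (avg f) (c * m)"
    unfolding m_def by (rule incr_avg[OF f])
  define \<Phi>' where "\<Phi>' t = (2 * avg f (2 * t) - avg f t - avg (avg f) t) / t" for t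
  note as1 = avg_asymp[OF f] and as2 = avg_asymp[OF meas incr]
  show thesis
  \<comment> \<open>The derivative of an average is available only strictly beyond
    \<open>T\<close>.\<close>
  proof (rule that[of "T + 1" \<Phi>'])
    show "(avg (avg f) has_real_derivative \<Phi>' t) (at t)" if "t \<ge> T + 1" for t
      unfolding \<Phi>'_def using that T(1) by (intro avg_has_real_derivative[OF cont]) auto
    show "continuous_on {T + 1..} \<Phi>'"
      unfolding \<Phi>'_def
      by (intro continuous_intros continuous_on_compose2[OF cont] continuous_on_compose2[OF cont2])
         (use T(1) in auto)
    show "(\<lambda>t. avg (avg f) t - f t - c * H * (1 + m) * g t) \<in> o[at_top](g)"
      using sum_in_smallo(1)[OF as1 as2] by (simp add: algebra_simps)
    have "(\<lambda>t. 2 * (avg f (2 * t) - avg f t - c * m * powint b 2 * g t)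
        - (avg (avg f) t - avg f t - c * m * H * g t)) \<in> o[at_top](g)"
    proof (rule sum_in_smallo(2)[OF _ as2])
      have "(\<lambda>t. avg f (2 * t) - avg f t - c * m * powint b 2 * g t) \<in> o[at_top](g)"
        using incr unfolding incr_def by simp
      then show "(\<lambda>t. 2 * (avg f (2 * t) - avg f t - c * m * powint b 2 * g t)) \<in> o[at_top](g)"
        by (subst landau_o.small.cmult_in_iff) simp_all
    qed
    moreover have "\<forall>\<^sub>F t in at_top. 2 * (avg f (2 * t) - avg f t - c * m * powint b 2 * g t)
        - (avg (avg f) t - avg f t - c * m * H * g t) = t * \<Phi>' t - c * m\<^sup>2 * g t"
      using eventually_gt_at_top[of 0]
    proof eventually_elim
      case (elim t)
      \<comment> \<open>Differentiation leaves the factor 2 \<open>powint b 2\<close> - H, which the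
        mean identity turns into \<open>m\<close>; the other factor \<open>m\<close> comes from the
        first average.\<close>
      have *: "c * m * powint b 2 * g t * 2 - c * m * H * g t = c * m\<^sup>2 * g t"
      proof -
        have "2 * powint b 2 - H = m"
          using powint_mean_identity(1)[of b] by (simp add: m_def H_def)
        then have "c * m * (2 * powint b 2 - H) * g t = c * m * m * g t" by simp
        then show ?thesis by (simp add: power2_eq_square algebra_simps)
      qed
      have "t * \<Phi>' t = 2 * avg f (2 * t) - avg f t - avg (avg f) t"
        using elim by (simp add: \<Phi>'_def)
      then show ?case using * by (simp add: algebra_simps)
    qed
    ultimately show "(\<lambda>t. t * \<Phi>' t - c * m\<^sup>2 * g t) \<in> o[at_top](g)"
      by (rule landau_o.small.in_cong[THEN iffD1, rotated])
  qed (use T(1) in auto)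
qed

lemma smooth_approximation:
  assumes f: "measurable_near_top f" "incr f c"
  obtains T \<Phi> \<Phi>' where "T > 0" "\<And>t. t \<ge> T \<Longrightarrow> (\<Phi> has_real_derivative \<Phi>' t) (at t)"
    "continuous_on {T..} \<Phi>'" "(\<lambda>t. f t - \<Phi> t) \<in> o[at_top](g)"
    "(\<lambda>t. t * \<Phi>' t - c * g t) \<in> o[at_top](g)"
proof -
  define m where "m = 1 + b * H"
  have m: "m > 0"
    using powint_mean_identity(2)[of b] by (simp add: m_def H_def)
  obtain T1 F' where F: "T1 > 0" "\<And>t. t \<ge> T1 \<Longrightarrow> (avg (avg f) has_real_derivative F' t) (at t)"
    "continuous_on {T1..} F'"
    "(\<lambda>t. avg (avg f) t - f t - c * H * (1 + m) * g t) \<in> o[at_top](g)"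
    "(\<lambda>t. t * F' t - c * m\<^sup>2 * g t) \<in> o[at_top](g)"
    by (rule avg_avg[OF f, folded m_def]) (rule that)
  obtain T2 G' where G: "T2 > 0" "\<And>t. t \<ge> T2 \<Longrightarrow> (avg (avg g) has_real_derivative G' t) (at t)"
    "continuous_on {T2..} G'"
    "(\<lambda>t. avg (avg g) t - g t - b * H * (1 + m) * g t) \<in> o[at_top](g)"
    "(\<lambda>t. t * G' t - b * m\<^sup>2 * g t) \<in> o[at_top](g)"
    by (rule avg_avg[OF g_meas incr_self, folded m_def]) (rule that)
  \<comment> \<open>Chosen to make p m^2 g, the main term of p times the twofold average of g, equal
    to the shift of the twofold average of f. Then \<open>e1\<close> settles the values, and
    \<open>e2\<close> shows that the slope comes out as c.\<close>
  define p where "p = c * H * (1 + m) / m\<^sup>2"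
  have p: "p * m\<^sup>2 = c * H * (1 + m)" using m by (simp add: p_def)
  have bH: "b * H = m - 1" by (simp add: m_def)
  show thesis
  proof (rule that[of "max T1 T2" "\<lambda>t. avg (avg f) t - p * avg (avg g) t" "\<lambda>t. F' t - p * G' t"])
    show "((\<lambda>t. avg (avg f) t - p * avg (avg g) t) has_real_derivative F' t - p * G' t) (at t)"
      if "t \<ge> max T1 T2" for t
      using that by (intro DERIV_diff DERIV_cmult F G) auto
    show "continuous_on {max T1 T2..} (\<lambda>t. F' t - p * G' t)"
      by (intro continuous_intros continuous_on_subset[OF F(3)] continuous_on_subset[OF G(3)]) auto
    have "p * (1 + b * H * (1 + m)) = p * m\<^sup>2"
      unfolding bH by (simp add: power2_eq_square algebra_simps)
    then have e1: "p * (1 + b * H * (1 + m)) = c * H * (1 + m)" by (simp add: p)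
    have "b * (p * m\<^sup>2) = c * (b * H) * (1 + m)" unfolding p by simp
    then have e2: "c * m\<^sup>2 - b * (p * m\<^sup>2) = c"
      unfolding bH by (simp add: power2_eq_square algebra_simps)
    have "(\<lambda>t. p * (avg (avg g) t - g t - b * H * (1 + m) * g t)
        - (avg (avg f) t - f t - c * H * (1 + m) * g t)) \<in> o[at_top](g)"
      using F(4) G(4) by (simp add: sum_in_smallo)
    moreover have "p * (avg (avg g) t - g t - b * H * (1 + m) * g t)
        - (avg (avg f) t - f t - c * H * (1 + m) * g t) = f t - (avg (avg f) t - p * avg (avg g) t)" for t
      using arg_cong[OF e1, of "\<lambda>z. z * g t"] by (simp add: algebra_simps)
    ultimately show "(\<lambda>t. f t - (avg (avg f) t - p * avg (avg g) t)) \<in> o[at_top](g)"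
      by simp
    have "(\<lambda>t. (t * F' t - c * m\<^sup>2 * g t) - p * (t * G' t - b * m\<^sup>2 * g t)) \<in> o[at_top](g)"
      using F(5) G(5) by (simp add: sum_in_smallo)
    moreover have "(t * F' t - c * m\<^sup>2 * g t) - p * (t * G' t - b * m\<^sup>2 * g t) = t * (F' t - p * G' t) - c * g t" for t
      using arg_cong[OF e2, of "\<lambda>z. z * g t"] by (simp add: algebra_simps)
    ultimately show "(\<lambda>t. t * (F' t - p * G' t) - c * g t) \<in> o[at_top](g)"
      by simp
  qed (use F(1) in auto)
qed

text \<open>The smooth approximation is the integral of its derivative. Writing that derivative as
  (c + \<epsilon>) g / u defines \<epsilon>, and the slope estimate says that \<epsilon> tends to
  0.\<close>

lemma integral_representation:
  assumes f: "measurable_near_top f" "incr f c"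
  obtains a a0 \<epsilon> where "a > 0" "\<epsilon> \<in> borel_measurable (lebesgue_on {a..})" "(\<epsilon> \<longlongrightarrow> 0) at_top"
    "\<And>t. t \<ge> a \<Longrightarrow> (\<lambda>u. (c + \<epsilon> u) * g u * inverse u) absolutely_integrable_on {a..t}"
    "(\<lambda>t. f t - (a0 + integral {a..t} (\<lambda>u. (c + \<epsilon> u) * g u * inverse u))) \<in> o[at_top](g)"
proof -
  obtain T \<Phi> \<Phi>' where \<Phi>: "T > 0" "\<And>t. t \<ge> T \<Longrightarrow> (\<Phi> has_real_derivative \<Phi>' t) (at t)"
    "continuous_on {T..} \<Phi>'" "(\<lambda>t. f t - \<Phi> t) \<in> o[at_top](g)"
    "(\<lambda>t. t * \<Phi>' t - c * g t) \<in> o[at_top](g)"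
    by (rule smooth_approximation[OF f]) (rule that)
  obtain t0 where t0: "g \<in> borel_measurable (lebesgue_on {t0..})"
    using g_meas unfolding measurable_near_top_def by blast
  obtain t1 where t1: "\<And>t. t \<ge> t1 \<Longrightarrow> g t \<noteq> 0"
    using g_nz unfolding eventually_at_top_linorder by blast
  \<comment> \<open>Beyond \<open>a\<close> the function \<open>g\<close> is measurable and nonzero,
    so the integrand built from \<epsilon> is exactly \<open>\<Phi>'\<close>.\<close>
  define a where "a = max T (max t0 t1)"
  have a: "a \<ge> T" "a \<ge> t0" "a \<ge> t1" "a > 0" using \<Phi>(1) by (auto simp: a_def)
  define \<epsilon> where "\<epsilon> u = u * \<Phi>' u / g u - c" for u
  have \<epsilon>: "(c + \<epsilon> u) * g u * inverse u = \<Phi>' u" if "u \<ge> a" for u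
    using t1[of u] a that by (simp add: \<epsilon>_def field_simps)
  have cont: "continuous_on {a..t} \<Phi>'" for t
    by (rule continuous_on_subset[OF \<Phi>(3)]) (use a in auto)
  show thesis
  proof (rule that[of a \<epsilon> "\<Phi> a"])
    have "g \<in> borel_measurable (lebesgue_on {a..})"
      using a by (intro measurable_restrict_mono[OF t0]) auto
    moreover have "\<Phi>' \<in> borel_measurable (lebesgue_on {a..})"
      by (rule continuous_imp_measurable_on_sets_lebesgue[OF continuous_on_subset[OF \<Phi>(3)]]) (use a in auto)
    moreover have "(\<lambda>u. u) \<in> borel_measurable (lebesgue_on {a..})"
      by (rule continuous_imp_measurable_on_sets_lebesgue) (auto intro: continuous_intros)
    ultimately show "\<epsilon> \<in> borel_measurable (lebesgue_on {a..})"
      unfolding \<epsilon>_def[abs_def]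
      by (intro borel_measurable_diff borel_measurable_divide borel_measurable_times borel_measurable_const)
    show "(\<epsilon> \<longlongrightarrow> 0) at_top"
    proof (rule Lim_transform_eventually[OF smalloD_tendsto[OF \<Phi>(5)]])
      show "\<forall>\<^sub>F t in at_top. (t * \<Phi>' t - c * g t) / g t = \<epsilon> t"
        using g_nz by eventually_elim (simp add: \<epsilon>_def diff_divide_distrib)
    qed
    show "(\<lambda>u. (c + \<epsilon> u) * g u * inverse u) absolutely_integrable_on {a..t}" for t
      using absolutely_integrable_continuous_real[OF cont[of t]]
      by (rule set_integrable_cong[THEN iffD1, rotated -1]) (auto simp: \<epsilon>)
    have "\<Phi> a + integral {a..t} (\<lambda>u. (c + \<epsilon> u) * g u * inverse u) = \<Phi> t" if "t \<ge> a" for t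
    proof -
      have "(\<Phi>' has_integral \<Phi> t - \<Phi> a) {a..t}"
        using that a
        by (intro fundamental_theorem_of_calculus)
           (auto simp: has_real_derivative_iff_has_vector_derivative[symmetric]
             intro!: has_field_derivative_at_within[OF \<Phi>(2)])
      then have "integral {a..t} \<Phi>' = \<Phi> t - \<Phi> a" by (rule integral_unique)
      moreover have "integral {a..t} (\<lambda>u. (c + \<epsilon> u) * g u * inverse u) = integral {a..t} \<Phi>'"
        by (rule integral_cong) (simp add: \<epsilon>)
      ultimately show ?thesis by simp
    qed
    then have "f t - (\<Phi> a + integral {a..t} (\<lambda>u. (c + \<epsilon> u) * g u * inverse u)) = f t - \<Phi> t" if "t \<ge> a" for t
      using that by (simp only:)
    then have "\<forall>\<^sub>F t in at_top. f t - (\<Phi> a + integral {a..t} (\<lambda>u. (c + \<epsilon> u) * g u * inverse u)) = f t - \<Phi> t"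
      unfolding eventually_at_top_linorder by blast
    then show "(\<lambda>t. f t - (\<Phi> a + integral {a..t} (\<lambda>u. (c + \<epsilon> u) * g u * inverse u))) \<in> o[at_top](g)"
      using \<Phi>(4) by (rule landau_o.small.in_cong[THEN iffD2])
  qed (use a in auto)
qed

text \<open>For x < 1, apply the relation at x t with factor 1 / x. Passing from g (x t) back to g t
  then costs an increment of g, which is known.\<close>

lemma incr_from_ge_1:
  assumes "\<And>x. x \<ge> 1 \<Longrightarrow> (\<lambda>t. f (x * t) - f t - c * powint b x * g t) \<in> o[at_top](g)"
  shows "incr f c"
  unfolding incr_def
proof (intro allI impI)
  fix x :: real assume x: "x > 0"
  show "(\<lambda>t. f (x * t) - f t - c * powint b x * g t) \<in> o[at_top](g)"
  proof (cases "x \<ge> 1")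
    case True
    then show ?thesis by (rule assms)
  next
    case False
    define y where "y = 1 / x"
    have y: "y \<ge> 1" "y * (x * t) = t" for t
      using x False by (auto simp: y_def)
    \<comment> \<open>The cocycle relation for x and 1 / x, whose product gives
      \<open>powint b 1\<close> = 0.\<close>
    have inv: "powint b x = - (x powr b * powint b y)"
      using powint_mult[of x y b] x by (simp add: y_def)
    have "(\<lambda>t. f (y * (x * t)) - f (x * t) - c * powint b y * g (x * t)) \<in> o[at_top](g)"
      using smallo_scale[OF assms[OF y(1)] x] .
    moreover have "(\<lambda>t. g (x * t) - g t - b * powint b x * g t) \<in> o[at_top](g)"
      using incr_self x unfolding incr_def by blast
    then have "(\<lambda>t. c * powint b y * (g (x * t) - g t - b * powint b x * g t)) \<in> o[at_top](g)"
      by simp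
    ultimately have "(\<lambda>t. (f (y * (x * t)) - f (x * t) - c * powint b y * g (x * t))
        + c * powint b y * (g (x * t) - g t - b * powint b x * g t)) \<in> o[at_top](g)"
      by (rule sum_in_smallo(1))
    then have "(\<lambda>t. - ((f (y * (x * t)) - f (x * t) - c * powint b y * g (x * t))
        + c * powint b y * (g (x * t) - g t - b * powint b x * g t))) \<in> o[at_top](g)"
      by (simp only: landau_o.small.uminus_in_iff)
    moreover have "- ((f (y * (x * t)) - f (x * t) - c * powint b y * g (x * t))
        + c * powint b y * (g (x * t) - g t - b * powint b x * g t))
      = f (x * t) - f t - c * powint b x * g t" for t
    proof -
      have "c * powint b y * g t + c * powint b y * (b * powint b x) * g t
          = c * powint b y * (1 + b * powint b x) * g t"
        by (simp add: algebra_simps)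
      also have "\<dots> = - (c * powint b x * g t)"
        unfolding powr_eq_powint[OF x, symmetric] by (simp add: inv mult_ac)
      finally have "c * powint b y * g t + c * powint b y * (b * powint b x) * g t = - (c * powint b x * g t)" .
      then show ?thesis unfolding y(2) by (simp add: algebra_simps)
    qed
    ultimately show ?thesis by (simp only:)
  qed
qed

text \<open>The converse estimate. On [t, x t] the hypothesis replaces D u by c g u / u, and uniform
  convergence replaces g u by (u / t)^b g t; the integral of (u / t)^b / u over [t, x t] is
  \<open>powint b x\<close>.\<close>

lemma incr_integral:
  assumes a: "a > 0" and int: "\<And>t. D integrable_on {a..t}"
    and D: "(\<lambda>t. t * D t - c * g t) \<in> o[at_top](g)"
  shows "incr (\<lambda>t. integral {a..t} D) c"
proof (rule incr_from_ge_1, rule landau_o.smallI)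
  fix x e :: real assume x: "x \<ge> 1" and e: "e > 0"
  \<comment> \<open>\<open>C\<close> bounds |g u / g t| on [t, x t]. In \<open>d\<close> below, the
    factor x pays for the length (x - 1) t of the interval, whose t cancels the 1 / t of the
    pointwise error.\<close>
  define C where "C = x powr \<bar>b\<bar> + 1"
  define d where "d = min 1 (e / ((C + \<bar>c\<bar>) * x))"
  have C: "C \<ge> 1" by (simp add: C_def)
  have "(C + \<bar>c\<bar>) * x > 0" using C x by (intro mult_pos_pos) auto
  then have d: "d > 0" "d \<le> 1" "d * (C + \<bar>c\<bar>) * x \<le> e"
  proof -
    assume pos: "(C + \<bar>c\<bar>) * x > 0"
    then show "d > 0" "d \<le> 1" using e by (auto simp: d_def)
    have "d \<le> e / ((C + \<bar>c\<bar>) * x)" by (simp add: d_def)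
    then show "d * (C + \<bar>c\<bar>) * x \<le> e"
      using pos by (simp add: pos_le_divide_eq mult.assoc)
  qed
  obtain T where T: "\<And>u. u \<ge> T \<Longrightarrow> \<bar>u * D u - c * g u\<bar> \<le> d * \<bar>g u\<bar>"
    using landau_o.smallD[OF D d(1)] unfolding eventually_at_top_linorder by auto
  show "\<forall>\<^sub>F t in at_top. norm (integral {a..x * t} D - integral {a..t} D - c * powint b x * g t) \<le> e * norm (g t)"
    using uniform_limitD[OF g_uniform_limit[OF x] d(1)] g_nz eventually_ge_at_top[of "max a T"]
  proof eventually_elim
    case (elim t)
    have t: "t > 0" "t \<ge> a" "t \<ge> T" using elim(3) a by auto
    have xt: "x * t \<ge> t" using mult_right_mono[of 1 x t] x t by simp
    have int_t: "D integrable_on {t..x*t}"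
      using int[of "x * t"] by (rule integrable_subinterval_real) (use t in auto)
    have comb: "integral {a..t} D + integral {t..x*t} D = integral {a..x*t} D"
      using t xt int by (intro Henstock_Kurzweil_Integration.integral_combine) auto
    have "((\<lambda>u. (u / t) powr b / u) has_integral powint b (x * t / t) - powint b (t / t)) {t..x*t}"
    proof (rule fundamental_theorem_of_calculus[OF xt])
      fix u assume u: "u \<in> {t..x*t}"
      have "((\<lambda>u. powint b (u / t)) has_real_derivative (u / t) powr (b - 1) * (1 / t)) (at u within {t..x*t})"
        by (rule DERIV_chain2[OF powint_has_real_derivative]) (use u t in \<open>auto intro!: derivative_eq_intros\<close>)
      also have "(u / t) powr (b - 1) * (1 / t) = (u / t) powr b / u"
        using u t by (simp add: powr_diff)
      finally show "((\<lambda>u. powint b (u / t)) has_vector_derivative (u / t) powr b / u) (at u within {t..x*t})"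
        by (simp add: has_real_derivative_iff_has_vector_derivative)
    qed
    then have "((\<lambda>u. c * ((u / t) powr b / u) * g t) has_integral c * powint b x * g t) {t..x*t}"
      using t by (intro has_integral_mult_left has_integral_mult_right) simp
    from has_integral_diff[OF integrable_integral[OF int_t] this]
    have "((\<lambda>u. D u - c * ((u / t) powr b / u) * g t) has_integral
        integral {a..x*t} D - integral {a..t} D - c * powint b x * g t) {t..x*t}"
      unfolding comb[symmetric] by simp
    then have "norm (integral {a..x*t} D - integral {a..t} D - c * powint b x * g t)
        \<le> d * (C + \<bar>c\<bar>) * \<bar>g t\<bar> / t * Sigma_Algebra.measure lborel {t..x*t}"
    proof (rule has_integral_bound_real[where S = "{}", rotated 2])
      show "norm (D u - c * ((u / t) powr b / u) * g t) \<le> d * (C + \<bar>c\<bar>) * \<bar>g t\<bar> / t"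
        if "u \<in> {t..x*t} - {}" for u
      proof -
        from that have u: "u \<ge> t" "u > 0" "u / t \<in> {1..x}" using t by (auto simp: field_simps)
        have "\<bar>g (u / t * t) / g t - (u / t) powr b\<bar> < d"
          using elim(1) u(3) unfolding dist_real_def by blast
        then have q: "\<bar>g u / g t - (u / t) powr b\<bar> < d"
          using t by simp
        have "\<bar>g u - (u / t) powr b * g t\<bar> = \<bar>g u / g t - (u / t) powr b\<bar> * \<bar>g t\<bar>"
          using elim(2) by (simp add: abs_mult[symmetric] left_diff_distrib)
        also have "\<dots> \<le> d * \<bar>g t\<bar>" using q by (intro mult_right_mono) auto
        finally have b1: "\<bar>g u - (u / t) powr b * g t\<bar> \<le> d * \<bar>g t\<bar>" .
        have "(u / t) powr b \<le> (u / t) powr \<bar>b\<bar>" using u(3) by (intro powr_mono) auto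
        also have "\<dots> \<le> x powr \<bar>b\<bar>" using u(3) by (intro powr_mono2) auto
        finally have "(u / t) powr b * \<bar>g t\<bar> \<le> x powr \<bar>b\<bar> * \<bar>g t\<bar>" by (intro mult_right_mono) auto
        moreover have "d * \<bar>g t\<bar> \<le> 1 * \<bar>g t\<bar>" using d by (intro mult_right_mono) auto
        moreover have "\<bar>g u\<bar> \<le> \<bar>g u - (u / t) powr b * g t\<bar> + (u / t) powr b * \<bar>g t\<bar>"
          using abs_triangle_ineq[of "g u - (u / t) powr b * g t" "(u / t) powr b * g t"] by (simp add: abs_mult)
        ultimately have b2: "\<bar>g u\<bar> \<le> C * \<bar>g t\<bar>" using b1 unfolding C_def by (simp add: algebra_simps)
        have "u * (D u - c * ((u / t) powr b / u) * g t) = (u * D u - c * g u) + c * (g u - (u / t) powr b * g t)"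
          using u(2) by (simp add: algebra_simps)
        then have "u * \<bar>D u - c * ((u / t) powr b / u) * g t\<bar> = \<bar>(u * D u - c * g u) + c * (g u - (u / t) powr b * g t)\<bar>"
          using u(2) by (metis abs_mult abs_of_pos)
        also have "\<dots> \<le> \<bar>u * D u - c * g u\<bar> + \<bar>c\<bar> * \<bar>g u - (u / t) powr b * g t\<bar>"
          unfolding abs_mult[symmetric] by (rule abs_triangle_ineq)
        also have "\<dots> \<le> d * (C * \<bar>g t\<bar>) + \<bar>c\<bar> * (d * \<bar>g t\<bar>)"
        proof (rule add_mono)
          have "\<bar>u * D u - c * g u\<bar> \<le> d * \<bar>g u\<bar>" using T u(1) t(3) by simp
          also have "\<dots> \<le> d * (C * \<bar>g t\<bar>)" using b2 d(1) by (intro mult_left_mono) auto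
          finally show "\<bar>u * D u - c * g u\<bar> \<le> d * (C * \<bar>g t\<bar>)" .
        qed (use b1 in \<open>intro mult_left_mono, auto\<close>)
        finally have "u * \<bar>D u - c * ((u / t) powr b / u) * g t\<bar> \<le> d * (C + \<bar>c\<bar>) * \<bar>g t\<bar>"
          by (simp add: algebra_simps)
        moreover have "t * \<bar>D u - c * ((u / t) powr b / u) * g t\<bar> \<le> u * \<bar>D u - c * ((u / t) powr b / u) * g t\<bar>"
          using u(1) by (intro mult_right_mono) auto
        ultimately show "norm (D u - c * ((u / t) powr b / u) * g t) \<le> d * (C + \<bar>c\<bar>) * \<bar>g t\<bar> / t"
          using t(1) by (simp add: pos_le_divide_eq mult.commute)
      qed
    qed (use d C t in auto)
    also have "\<dots> = d * (C + \<bar>c\<bar>) * (x - 1) * \<bar>g t\<bar>"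
      using xt t by (simp add: field_simps)
    also have "\<dots> \<le> e * \<bar>g t\<bar>"
    proof (rule mult_right_mono)
      have "d * (C + \<bar>c\<bar>) * (x - 1) \<le> d * (C + \<bar>c\<bar>) * x"
        using d C by (intro mult_left_mono) auto
      then show "d * (C + \<bar>c\<bar>) * (x - 1) \<le> e" using d(3) by linarith
    qed simp
    finally show ?case by simp
  qed
qed

end

section \<open>Powers of a triangular matrix with distinct eigenvalues\<close>

text \<open>Back substitution for an eigenvector to the j-th diagonal entry: component j is 1, those
  below vanish, and those above follow upwards from the rows of (B - B_jj) v = 0. Row i divides by
  B_jj - B_ii, which is where distinct diagonal entries are used.\<close>

function eigencolumn :: "real mat \<Rightarrow> nat \<Rightarrow> nat \<Rightarrow> real" where
  "eigencolumn B j i = (if i = j then 1 else if i > j then 0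
     else (\<Sum>k\<in>{i<..j}. B $$ (i, k) * eigencolumn B j k) / (B $$ (j, j) - B $$ (i, i)))"
  by auto
termination by (relation "Wellfounded.measure (\<lambda>(B, j, i). j - i)") auto

declare eigencolumn.simps [simp del]

lemma eigencolumn_diag [simp]: "eigencolumn B j j = 1"
  by (subst eigencolumn.simps) simp

lemma eigencolumn_below [simp]: "j < i \<Longrightarrow> eigencolumn B j i = 0"
  by (subst eigencolumn.simps) simp

text \<open>The eigencolumns form a unit upper triangular matrix; its determinant is 1, so it has a
  two-sided inverse.\<close>

lemma upper_triangular_diagonalization:
  fixes B :: "real mat"
  assumes B: "B \<in> carrier_mat n n" "upper_triangular B"
    and distinct: "\<And>i j. i < j \<Longrightarrow> j < n \<Longrightarrow> B $$ (i, i) \<noteq> B $$ (j, j)"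
  obtains P Q where "P \<in> carrier_mat n n" "Q \<in> carrier_mat n n" "P * Q = 1\<^sub>m n" "Q * P = 1\<^sub>m n"
    "upper_triangular P" "\<And>i. i < n \<Longrightarrow> P $$ (i, i) = 1"
    "B * P = P * mat_diag n (\<lambda>i. B $$ (i, i))"
proof -
  define P where "P = mat n n (\<lambda>(i, j). eigencolumn B j i)"
  have P: "P \<in> carrier_mat n n" by (simp add: P_def)
  have ut: "upper_triangular P" by (auto simp: P_def)
  have diag: "P $$ (i, i) = 1" if "i < n" for i using that by (simp add: P_def)
  have "det P = prod_list (diag_mat P)"
    by (rule det_upper_triangular[OF ut P])
  also have "diag_mat P = map (\<lambda>_. 1) [0..<n]"
    using P diag by (auto simp: diag_mat_def)
  also have "prod_list (map (\<lambda>_. 1 :: real) [0..<n]) = 1"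
    by (induction n) auto
  finally have "det P \<noteq> 0" by simp
  from det_non_zero_imp_unit[OF P this, of "()"]
  obtain Q where Q: "Q \<in> carrier_mat n n" "P * Q = 1\<^sub>m n" "Q * P = 1\<^sub>m n"
    unfolding Units_def ring_mat_def by auto
  have "B * P = P * mat_diag n (\<lambda>i. B $$ (i, i))"
  proof (rule eq_matI)
    fix i j assume "i < dim_row (P * mat_diag n (\<lambda>i. B $$ (i, i)))" "j < dim_col (P * mat_diag n (\<lambda>i. B $$ (i, i)))"
    then have ij: "i < n" "j < n" using P by (auto simp: mat_diag_def)
    have "(B * P) $$ (i, j) = (\<Sum>k\<in>{0..<n}. B $$ (i, k) * eigencolumn B j k)"
      using B P ij by (simp add: scalar_prod_def P_def)
    \<comment> \<open>For k < i the entry of \<open>B\<close> vanishes, for k > j that of the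
      eigencolumn; if i > j nothing remains.\<close>
    also have "\<dots> = (\<Sum>k\<in>{i..j}. B $$ (i, k) * eigencolumn B j k)"
    proof (rule sum.mono_neutral_right)
      show "\<forall>k\<in>{0..<n} - {i..j}. B $$ (i, k) * eigencolumn B j k = 0"
        using upper_triangularD[OF B(2)] B(1) ij by (auto simp: not_le)
    qed (use ij in auto)
    also have "\<dots> = eigencolumn B j i * B $$ (j, j)"
    proof -
      consider "i > j" | "i = j" | "i < j" by linarith
      then show ?thesis
      proof cases
        case 3
        have "{i..j} = insert i {i<..j}" using 3 by auto
        then have "(\<Sum>k\<in>{i..j}. B $$ (i, k) * eigencolumn B j k)
            = B $$ (i, i) * eigencolumn B j i + (\<Sum>k\<in>{i<..j}. B $$ (i, k) * eigencolumn B j k)"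
          by simp
        also have "(\<Sum>k\<in>{i<..j}. B $$ (i, k) * eigencolumn B j k) = (B $$ (j, j) - B $$ (i, i)) * eigencolumn B j i"
          using distinct[OF 3 ij(2)] 3 by (subst (2) eigencolumn.simps) simp
        finally show ?thesis by (simp add: algebra_simps)
      qed auto
    qed
    also have "\<dots> = (P * mat_diag n (\<lambda>i. B $$ (i, i))) $$ (i, j)"
      using P ij by (subst mat_diag_mult_right[OF P]) (simp add: P_def)
    finally show "(B * P) $$ (i, j) = (P * mat_diag n (\<lambda>i. B $$ (i, i))) $$ (i, j)" .
  qed (use B P in \<open>auto simp: mat_diag_def\<close>)
  with P Q ut diag show thesis by (intro that) auto
qed

section \<open>Spectral formulas for the matrix power and its integral\<close>

lemma index_mult_mat_sum:
  assumes "A \<in> carrier_mat n m" "B \<in> carrier_mat m k" "i < n" "j < k"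
  shows "(A * B) $$ (i, j) = (\<Sum>l<m. A $$ (i, l) * B $$ (l, j))"
  using assms by (auto simp: scalar_prod_def atLeast0LessThan intro!: sum.cong)

lemma index_mult_mat_vec_sum:
  assumes "A \<in> carrier_mat n m" "v \<in> carrier_vec m" "i < n"
  shows "(A *\<^sub>v v) $ i = (\<Sum>l<m. A $$ (i, l) * v $ l)"
  using assms by (auto simp: scalar_prod_def atLeast0LessThan intro!: sum.cong)

locale diagonalized =
  fixes n :: nat and B P Q :: "real mat" and d :: "nat \<Rightarrow> real"
  assumes B: "B \<in> carrier_mat n n" and P: "P \<in> carrier_mat n n" and Q: "Q \<in> carrier_mat n n"
    and PQ: "P * Q = 1\<^sub>m n" and QP: "Q * P = 1\<^sub>m n"
    and BP: "B * P = P * mat_diag n d"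
begin

text \<open>\<open>P\<close> intertwines the k-th power with that of the diagonal matrix. Entries
  are spelled out because the matrix exponential is an entrywise series; \<open>c\<close> will be ln
  x.\<close>

lemma pow_B:
  assumes "i < n" "j < n"
  shows "((c \<cdot>\<^sub>m B) ^\<^sub>m k) $$ (i, j) = (\<Sum>l<n. P $$ (i, l) * (c * d l) ^ k * Q $$ (l, j))"
proof -
  have D: "mat_diag n f \<in> carrier_mat n n" for f :: "nat \<Rightarrow> real" by simp
  have *: "((c \<cdot>\<^sub>m B) ^\<^sub>m k) * P = P * mat_diag n (\<lambda>l. (c * d l) ^ k)"
  proof (induction k)
    case 0
    then show ?case using P B by (simp add: mat_diag_one)
  next
    case (Suc k)
    have "((c \<cdot>\<^sub>m B) ^\<^sub>m Suc k) * P = ((c \<cdot>\<^sub>m B) ^\<^sub>m k) * ((c \<cdot>\<^sub>m B) * P)"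
      using B P by (simp add: assoc_mult_mat[of _ n n _ n _ n] pow_carrier_mat)
    also have "(c \<cdot>\<^sub>m B) * P = c \<cdot>\<^sub>m (P * mat_diag n d)"
      using B P by (simp add: mult_smult_assoc_mat[of _ n n _ n] BP)
    also have "\<dots> = P * mat_diag n (\<lambda>l. c * d l)"
      by (rule eq_matI) (use P in \<open>auto simp: mat_diag_mult_right[OF P]\<close>)
    also have "((c \<cdot>\<^sub>m B) ^\<^sub>m k) * (P * mat_diag n (\<lambda>l. c * d l)) = (((c \<cdot>\<^sub>m B) ^\<^sub>m k) * P) * mat_diag n (\<lambda>l. c * d l)"
      using B P by (simp add: assoc_mult_mat[of _ n n _ n _ n] pow_carrier_mat)
    also have "\<dots> = P * (mat_diag n (\<lambda>l. (c * d l) ^ k) * mat_diag n (\<lambda>l. c * d l))"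
      using P D by (simp add: Suc assoc_mult_mat[of _ n n _ n _ n])
    also have "\<dots> = P * mat_diag n (\<lambda>l. (c * d l) ^ Suc k)"
      by (simp add: mat_diag_diag mult.commute)
    finally show ?case .
  qed
  have "(c \<cdot>\<^sub>m B) ^\<^sub>m k = ((c \<cdot>\<^sub>m B) ^\<^sub>m k) * (P * Q)"
    using B by (simp add: PQ pow_carrier_mat)
  also have "\<dots> = P * mat_diag n (\<lambda>l. (c * d l) ^ k) * Q"
    using B P Q by (simp add: assoc_mult_mat[of _ n n _ n _ n, symmetric] pow_carrier_mat *)
  finally show ?thesis
    using assms P Q by (simp add: index_mult_mat_sum[of _ n n _ n] mat_diag_mult_right[OF P]
        scalar_prod_def atLeast0LessThan)
qed

text \<open>The series of an entry is a finite combination, over the eigenvalues, of scalar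
  exponential series, so it can be summed separately for each eigenvalue.\<close>

lemma index_mat_powr:
  assumes "i < n" "j < n" "x > 0"
  shows "mat_powr x B $$ (i, j) = (\<Sum>l<n. P $$ (i, l) * x powr d l * Q $$ (l, j))"
proof -
  have "mat_powr x B $$ (i, j) = (\<Sum>k. (\<Sum>l<n. P $$ (i, l) * ((ln x * d l) ^ k / fact k) * Q $$ (l, j)))"
    using B assms unfolding mat_powr_def mat_exp_def
    by (simp add: pow_B sum_divide_distrib)
  also have "\<dots> = (\<Sum>l<n. P $$ (i, l) * exp (ln x * d l) * Q $$ (l, j))"
  proof (rule sums_unique[symmetric], intro sums_sum sums_mult sums_mult2)
    show "(\<lambda>k. (ln x * d l) ^ k / fact k) sums exp (ln x * d l)" for l
      using exp_converges[of "ln x * d l"] by (simp add: scaleR_conv_of_real field_simps)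
  qed
  finally show ?thesis
    using assms(3) by (simp add: powr_def mult.commute)
qed

lemma index_mat_powr_integral:
  assumes "i < n" "j < n" "x > 0"
  shows "mat_powr_integral B x $$ (i, j) = (\<Sum>l<n. P $$ (i, l) * powint (d l) x * Q $$ (l, j))"
proof -
  define F where "F y = (\<Sum>l<n. P $$ (i, l) * powint (d l) y * Q $$ (l, j))" for y
  define f where "f y = (\<Sum>l<n. P $$ (i, l) * y powr (d l - 1) * Q $$ (l, j))" for y
  have pos: "y > 0" if "y \<in> {min 1 x..max 1 x}" for y
    using that assms(3) by (auto simp: min_def split: if_splits)
  have "mat_powr_integral B x $$ (i, j) = (LINT y=ereal 1..ereal x|lebesgue. (mat_powr y B $$ (i, j) * inverse y))"
    using B assms by (simp add: mat_powr_integral_def)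
  also have "\<dots> = (LINT y=ereal 1..ereal x|lebesgue. (f y))"
  proof -
    have "mat_powr y B $$ (i, j) * inverse y = f y" if "y > 0" for y
      using assms that unfolding f_def
      by (simp add: index_mat_powr sum_distrib_right sum_distrib_left powr_diff mult_ac divide_inverse)
    \<comment> \<open>The formula for the matrix power is available at positive \<open>y\<close>
      only; in either orientation the open interval between 1 and \<open>x\<close> lies
      there.\<close>
    moreover have "y > 0" if "y \<in> einterval (ereal 1) (ereal x) \<or> y \<in> einterval (ereal x) (ereal 1)" for y
      using that assms(3) by (auto simp: einterval_iff)
    ultimately have "mat_powr y B $$ (i, j) * inverse y = f y"
      if "y \<in> einterval (ereal 1) (ereal x) \<or> y \<in> einterval (ereal x) (ereal 1)" for y
      using that by blast
    then have "(LINT y:einterval (ereal 1) (ereal x)|lebesgue. (mat_powr y B $$ (i, j) * inverse y)) = (LINT y:einterval (ereal 1) (ereal x)|lebesgue. (f y))"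
      "(LINT y:einterval (ereal x) (ereal 1)|lebesgue. (mat_powr y B $$ (i, j) * inverse y)) = (LINT y:einterval (ereal x) (ereal 1)|lebesgue. (f y))"
      by (auto intro!: set_lebesgue_integral_cong)
    then show ?thesis
      unfolding interval_lebesgue_integral_def by presburger
  qed
  also have "\<dots> = F x - F 1"
  proof (rule interval_lebesgue_integral_FTC)
    show "continuous_on {min 1 x..max 1 x} f"
      unfolding f_def by (intro continuous_intros) (auto dest: pos)
    show "(F has_real_derivative f y) (at y)" if "y \<in> {min 1 x..max 1 x}" for y
      unfolding F_def f_def
      by (intro DERIV_sum DERIV_cmult DERIV_cmult_right powint_has_real_derivative pos that)
  qed
  finally show ?thesis by (simp add: F_def)
qed

end

section \<open>Representation theorem\<close>

context rv_rate
begin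

text \<open>Division by t^\<beta> turns the hypothesis into plain increments of \<gamma>
  t^(-\<beta>) with rate g t^(-\<beta>). The doubling ratio of that rate tends to 2^(b - \<beta>) <
  1, so asymptotic constancy yields C.\<close>

lemma power_asymptotics:
  assumes \<beta>: "b < \<beta>"
    and incr: "\<And>x. x \<ge> 1 \<Longrightarrow> (\<lambda>t. \<gamma> (x * t) - x powr \<beta> * \<gamma> t) \<in> o[at_top](g)"
  shows "\<exists>C. (\<lambda>t. \<gamma> t - C * t powr \<beta>) \<in> o[at_top](g)"
proof -
  have "\<exists>C. (\<lambda>t. \<gamma> t * t powr (-\<beta>) - C) \<in> o[at_top](\<lambda>t. g t * t powr (-\<beta>))"
  proof (rule limit_constant_of_increments)
    show "\<forall>\<^sub>F t in at_top. g t * t powr (-\<beta>) \<noteq> 0"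
      using g_nz eventually_gt_at_top[of 0] by eventually_elim simp
    have "((\<lambda>t. g (2 * t) / g t * 2 powr (-\<beta>)) \<longlongrightarrow> 2 powr b * 2 powr (-\<beta>)) at_top"
      by (intro tendsto_intros g_lim) simp
    then have "((\<lambda>t. g (2 * t) / g t * 2 powr (-\<beta>)) \<longlongrightarrow> 2 powr (b - \<beta>)) at_top"
      by (simp flip: powr_add)
    then show "((\<lambda>t. (g (2 * t) * (2 * t) powr (-\<beta>)) / (g t * t powr (-\<beta>))) \<longlongrightarrow> 2 powr (b - \<beta>)) at_top"
    proof (rule Lim_transform_eventually)
      show "\<forall>\<^sub>F t in at_top. g (2 * t) / g t * 2 powr (-\<beta>) = (g (2 * t) * (2 * t) powr (-\<beta>)) / (g t * t powr (-\<beta>))"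
        using g_nz eventually_gt_at_top[of 0] by eventually_elim (simp add: powr_mult)
    qed
    show "\<bar>2 powr (b - \<beta>)\<bar> < (1 :: real)"
      using \<beta> powr_less_mono[of "b - \<beta>" 0 2] by simp
  next
    fix x :: real assume x: "x \<ge> 1"
    have "(\<lambda>t. x powr (-\<beta>) * (\<gamma> (x * t) - x powr \<beta> * \<gamma> t)) \<in> o[at_top](g)"
      using incr[OF x] by simp
    then have "(\<lambda>t. x powr (-\<beta>) * (\<gamma> (x * t) - x powr \<beta> * \<gamma> t) * t powr (-\<beta>)) \<in> o[at_top](\<lambda>t. g t * t powr (-\<beta>))"
      by (rule landau_o.small_big_mult) simp
    moreover have "\<forall>\<^sub>F t in at_top. x powr (-\<beta>) * (\<gamma> (x * t) - x powr \<beta> * \<gamma> t) * t powr (-\<beta>)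
        = \<gamma> (x * t) * (x * t) powr (-\<beta>) - \<gamma> t * t powr (-\<beta>)"
      using eventually_gt_at_top[of 0]
    proof eventually_elim
      case (elim t)
      have "x powr (-\<beta>) * x powr \<beta> = 1" using x by (simp flip: powr_add)
      then have "x powr (-\<beta>) * (x powr \<beta> * z) = z" for z by (simp flip: mult.assoc)
      then show ?case using elim x by (simp add: powr_mult algebra_simps)
    qed
    ultimately show "(\<lambda>t. \<gamma> (x * t) * (x * t) powr (-\<beta>) - \<gamma> t * t powr (-\<beta>)) \<in> o[at_top](\<lambda>t. g t * t powr (-\<beta>))"
      by (rule landau_o.small.in_cong[THEN iffD1, rotated])
  qed
  then obtain C where "(\<lambda>t. \<gamma> t * t powr (-\<beta>) - C) \<in> o[at_top](\<lambda>t. g t * t powr (-\<beta>))" by blast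
  then have "(\<lambda>t. (\<gamma> t * t powr (-\<beta>) - C) * t powr \<beta>) \<in> o[at_top](\<lambda>t. g t * t powr (-\<beta>) * t powr \<beta>)"
    by (rule landau_o.small_big_mult) simp
  also have "(\<lambda>t. g t * t powr (-\<beta>) * t powr \<beta>) \<in> \<Theta>[at_top](g)"
  proof (rule bigthetaI_cong)
    show "\<forall>\<^sub>F t in at_top. g t * t powr (-\<beta>) * t powr \<beta> = g t"
      using eventually_gt_at_top[of 0] by eventually_elim (simp add: mult.assoc flip: powr_add)
  qed
  finally have "(\<lambda>t. (\<gamma> t * t powr (-\<beta>) - C) * t powr \<beta>) \<in> o[at_top](g)" .
  moreover have "\<forall>\<^sub>F t in at_top. (\<gamma> t * t powr (-\<beta>) - C) * t powr \<beta> = \<gamma> t - C * t powr \<beta>"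
    using eventually_gt_at_top[of 0] by eventually_elim (simp add: left_diff_distrib mult.assoc flip: powr_add)
  ultimately have "(\<lambda>t. \<gamma> t - C * t powr \<beta>) \<in> o[at_top](g)"
    by (rule landau_o.small.in_cong[THEN iffD1, rotated])
  then show ?thesis by blast
qed

text \<open>Each doubling of a large t multiplies |g t| t^(-\<beta>) by at most q < 1. Uniform
  convergence bounds this quantity on a first block [T, 2 T], whence the bound q^n K beyond 2^n T.
  The ordering of the constructed rate vector rests on this.\<close>

lemma g_smallo_powr:
  assumes \<beta>: "b < \<beta>"
  shows "g \<in> o[at_top](\<lambda>t. t powr \<beta>)"
proof -
  define \<rho> where "\<rho> t = g t * t powr (-\<beta>)" for t
  \<comment> \<open>The midpoint between 1 and the limit of the doubling ratio; any number strictly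
    between would do.\<close>
  define q where "q = (2 powr (b - \<beta>) + 1) / 2"
  have lt1: "2 powr (b - \<beta>) < (1 :: real)"
    using \<beta> powr_less_mono[of "b - \<beta>" 0 2] by simp
  then have q: "0 < q" "q < 1" "2 powr (b - \<beta>) < q"
    unfolding q_def by (auto intro: add_pos_pos)
  have "((\<lambda>t. \<bar>g (2 * t) / g t\<bar> * 2 powr (-\<beta>)) \<longlongrightarrow> \<bar>2 powr b\<bar> * 2 powr (-\<beta>)) at_top"
    by (intro tendsto_intros g_lim) simp
  then have "\<forall>\<^sub>F t in at_top. \<bar>g (2 * t) / g t\<bar> * 2 powr (-\<beta>) < q"
    by (rule order_tendstoD(2)) (use q(3) in \<open>simp flip: powr_add\<close>)
  then have "\<forall>\<^sub>F t in at_top. \<bar>\<rho> (2 * t)\<bar> \<le> q * \<bar>\<rho> t\<bar>"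
    using g_nz eventually_gt_at_top[of 0]
  proof eventually_elim
    case (elim t)
    then have "\<bar>g (2 * t)\<bar> * 2 powr (-\<beta>) \<le> q * \<bar>g t\<bar>"
      by (simp add: abs_divide field_simps)
    then have "\<bar>g (2 * t)\<bar> * 2 powr (-\<beta>) * t powr (-\<beta>) \<le> q * \<bar>g t\<bar> * t powr (-\<beta>)"
      by (rule mult_right_mono) simp
    then show ?case using elim by (simp add: \<rho>_def abs_mult powr_mult mult_ac)
  qed
  moreover have "\<forall>\<^sub>F t in at_top. \<forall>x\<in>{1..2}. dist (g (x * t) / g t) (x powr b) < 1"
    by (rule uniform_limitD[OF g_uniform_limit]) auto
  ultimately have "\<forall>\<^sub>F t in at_top. t \<ge> 1 \<and> g t \<noteq> 0 \<and> \<bar>\<rho> (2 * t)\<bar> \<le> q * \<bar>\<rho> t\<bar>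
      \<and> (\<forall>x\<in>{1..2}. dist (g (x * t) / g t) (x powr b) < 1)"
    using g_nz eventually_ge_at_top[of 1] by eventually_elim blast
  then obtain T where T: "\<And>t. t \<ge> T \<Longrightarrow> t \<ge> 1" "\<And>t. t \<ge> T \<Longrightarrow> \<bar>\<rho> (2 * t)\<bar> \<le> q * \<bar>\<rho> t\<bar>" "g T \<noteq> 0"
    "\<And>x. x \<in> {1..2} \<Longrightarrow> \<bar>g (x * T) / g T - x powr b\<bar> < 1"
    unfolding eventually_at_top_linorder dist_real_def by blast
  have T1: "T \<ge> 1" using T(1)[of T] by simp
  \<comment> \<open>A product of bounds for |g t| and t^(-\<beta>) on [T, 2 T]; absolute values of
    the exponents cover both signs.\<close>
  define K where "K = (2 powr \<bar>b\<bar> + 1) * \<bar>g T\<bar> * (T powr \<bar>\<beta>\<bar> * 2 powr \<bar>\<beta>\<bar>)"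
  have base: "\<bar>\<rho> t\<bar> \<le> K" if "t \<in> {T..2*T}" for t
  proof -
    have x: "t / T \<in> {1..2}" "t / T * T = t" using that T1 by (auto simp: field_simps)
    have "\<bar>g t / g T\<bar> \<le> (t / T) powr b + 1"
      using T(4)[OF x(1)] unfolding x(2) by (smt (verit) powr_ge_zero)
    also have "(t / T) powr b \<le> (t / T) powr \<bar>b\<bar>" using x(1) by (intro powr_mono) auto
    also have "(t / T) powr \<bar>b\<bar> \<le> 2 powr \<bar>b\<bar>" using x(1) by (intro powr_mono2) auto
    finally have "\<bar>g t\<bar> \<le> (2 powr \<bar>b\<bar> + 1) * \<bar>g T\<bar>"
      using T(3) by (simp add: abs_divide pos_divide_le_eq)
    moreover have "t powr (-\<beta>) \<le> T powr \<bar>\<beta>\<bar> * 2 powr \<bar>\<beta>\<bar>"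
    proof -
      have "t powr (-\<beta>) \<le> t powr \<bar>\<beta>\<bar>" using that T1 by (intro powr_mono) auto
      also have "\<dots> \<le> (T * 2) powr \<bar>\<beta>\<bar>" using that T1 by (intro powr_mono2) auto
      finally show ?thesis using T1 by (simp add: powr_mult)
    qed
    ultimately show ?thesis
      unfolding \<rho>_def K_def abs_mult by (intro mult_mono) auto
  qed
  have K: "K \<ge> 0" using base[of T] T1 by auto
  have bound: "\<bar>\<rho> t\<bar> \<le> K" if "t \<in> {T..2 ^ n * T}" for n t
    using that
  proof (induction n arbitrary: t)
    case 0
    then show ?case using base[of t] T1 by auto
  next
    case (Suc n)
    show ?case
    proof (cases "t \<le> 2 * T")
      case True
      then show ?thesis using base Suc.prems by auto
    next
      case False
      then have t2: "t / 2 \<in> {T..2 ^ n * T}" using Suc.prems by auto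
      have "\<bar>\<rho> (2 * (t / 2))\<bar> \<le> q * \<bar>\<rho> (t / 2)\<bar>" using t2 by (intro T(2)) auto
      also have "\<dots> \<le> 1 * K" using Suc.IH[OF t2] q by (intro mult_mono) auto
      finally show ?thesis by simp
    qed
  qed
  have bound': "\<bar>\<rho> t\<bar> \<le> q ^ n * K" if "t \<ge> 2 ^ n * T" for n t
    using that
  proof (induction n arbitrary: t)
    case 0
    obtain n where "t / T < 2 ^ n"
      using real_arch_pow[of 2 "t / T"] by auto
    then have "t \<in> {T..2 ^ n * T}" using 0 T1 by (simp add: field_simps)
    then show ?case using bound by simp
  next
    case (Suc n)
    then have t2: "t / 2 \<ge> 2 ^ n * T" by simp
    have "2 ^ n * T \<ge> T" using T1 mult_right_mono[of 1 "2 ^ n" T] by simp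
    then have "\<bar>\<rho> (2 * (t / 2))\<bar> \<le> q * \<bar>\<rho> (t / 2)\<bar>" using t2 by (intro T(2)) auto
    also have "\<dots> \<le> q * (q ^ n * K)" using Suc.IH[OF t2] q by (intro mult_left_mono) auto
    finally show ?case by simp
  qed
  have "(\<rho> \<longlongrightarrow> 0) at_top"
  proof (rule tendstoI)
    fix e :: real assume e: "e > 0"
    have "(\<lambda>n. q ^ n * K) \<longlonglongrightarrow> 0"
      using q by (intro tendsto_mult_left_zero LIMSEQ_power_zero) simp
    then have "\<forall>\<^sub>F n in sequentially. q ^ n * K < e"
      using e by (rule order_tendstoD(2))
    then obtain n where n: "q ^ n * K < e"
      by (auto simp: eventually_sequentially)
    show "\<forall>\<^sub>F t in at_top. dist (\<rho> t) 0 < e"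
      using eventually_ge_at_top[of "2 ^ n * T"]
      by eventually_elim (use bound'[of n] n in \<open>fastforce simp: dist_real_def\<close>)
  qed
  then show ?thesis
  proof (intro smalloI_tendsto)
    assume "(\<rho> \<longlongrightarrow> 0) at_top"
    then show "((\<lambda>t. g t / t powr \<beta>) \<longlongrightarrow> 0) at_top"
      by (simp add: \<rho>_def[abs_def] powr_minus divide_inverse)
    show "\<forall>\<^sub>F t in at_top. t powr \<beta> \<noteq> 0"
      using eventually_gt_at_top[of 0] by eventually_elim simp
  qed
qed

end

section \<open>Matrix relations in eigen-coordinates\<close>

context diagonalized
begin

lemma sum_QP:
  assumes "m < n" "l < n"
  shows "(\<Sum>i<n. Q $$ (m, i) * P $$ (i, l)) = (if m = l then 1 else 0)"
  using arg_cong[OF QP, of "\<lambda>A. A $$ (m, l)"] assms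
  by (simp add: index_mult_mat_sum[OF Q P] del: index_mult_mat)

lemma mat_powr_mult_vec:
  assumes "v \<in> carrier_vec n" "i < n" "x > 0"
  shows "(mat_powr x B *\<^sub>v v) $ i = (\<Sum>l<n. P $$ (i, l) * x powr d l * (Q *\<^sub>v v) $ l)"
proof -
  have "mat_powr x B \<in> carrier_mat n n"
    using B by (simp add: mat_powr_def mat_exp_def)
  then have "(mat_powr x B *\<^sub>v v) $ i = (\<Sum>j<n. (\<Sum>l<n. P $$ (i, l) * x powr d l * Q $$ (l, j)) * v $ j)"
    using assms by (simp add: index_mult_mat_vec_sum index_mat_powr del: index_mult_mat_vec)
  also have "\<dots> = (\<Sum>l<n. \<Sum>j<n. P $$ (i, l) * x powr d l * (Q $$ (l, j) * v $ j))"
    unfolding sum_distrib_right by (subst sum.swap) (simp add: mult.assoc)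
  also have "\<dots> = (\<Sum>l<n. P $$ (i, l) * x powr d l * (Q *\<^sub>v v) $ l)"
    using assms(1) by (simp add: index_mult_mat_vec_sum[OF Q] sum_distrib_left del: index_mult_mat_vec)
  finally show ?thesis .
qed

text \<open>The row vector enters only through c P, whose entries become the coefficients of the
  decoupled increments of f.\<close>

lemma mat_powr_integral_mult_vec:
  assumes "c \<in> carrier_mat 1 n" "v \<in> carrier_vec n" "x > 0"
  shows "((c * mat_powr_integral B x) *\<^sub>v v) $ 0
    = (\<Sum>l<n. (\<Sum>i<n. c $$ (0, i) * P $$ (i, l)) * powint (d l) x * (Q *\<^sub>v v) $ l)"
proof -
  have M: "mat_powr_integral B x \<in> carrier_mat n n"
    using B by (simp add: mat_powr_integral_def)
  then have "c * mat_powr_integral B x \<in> carrier_mat 1 n"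
    using assms(1) by simp
  then have "((c * mat_powr_integral B x) *\<^sub>v v) $ 0
      = (\<Sum>j<n. (\<Sum>i<n. c $$ (0, i) * (\<Sum>l<n. P $$ (i, l) * powint (d l) x * Q $$ (l, j))) * v $ j)"
    using assms
    by (simp add: index_mult_mat_vec_sum index_mult_mat_sum[OF assms(1) M] index_mat_powr_integral
        del: index_mult_mat_vec index_mult_mat)
  also have "\<dots> = (\<Sum>j<n. \<Sum>i<n. \<Sum>l<n. c $$ (0, i) * P $$ (i, l) * powint (d l) x * (Q $$ (l, j) * v $ j))"
    by (simp add: sum_distrib_left sum_distrib_right mult_ac)
  also have "\<dots> = (\<Sum>j<n. \<Sum>l<n. \<Sum>i<n. c $$ (0, i) * P $$ (i, l) * powint (d l) x * (Q $$ (l, j) * v $ j))"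
    by (intro sum.cong refl sum.swap)
  also have "\<dots> = (\<Sum>l<n. \<Sum>j<n. \<Sum>i<n. c $$ (0, i) * P $$ (i, l) * powint (d l) x * (Q $$ (l, j) * v $ j))"
    by (rule sum.swap)
  also have "\<dots> = (\<Sum>l<n. (\<Sum>i<n. c $$ (0, i) * P $$ (i, l)) * powint (d l) x * (Q *\<^sub>v v) $ l)"
    using assms(2)
    by (simp add: index_mult_mat_vec_sum[OF Q] sum_distrib_left sum_distrib_right del: index_mult_mat_vec)
  finally show ?thesis .
qed

end

section \<open>From a rate vector to a representation\<close>

locale triangular_rate = diagonalized n B P Q d + rv_rate g "d (n - 1)"
  for n :: nat and B P Q :: "real mat" and d :: "nat \<Rightarrow> real" and g :: "real \<Rightarrow> real" +
  assumes n: "n \<ge> 2"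
    and P_upper: "upper_triangular P" and P_diag: "\<And>i. i < n \<Longrightarrow> P $$ (i, i) = 1"
    and d_decreasing: "\<And>i j. i < j \<Longrightarrow> j < n \<Longrightarrow> d j < d i"
begin

text \<open>The power integrals are replaced by \<open>powint\<close> and the last integral by a
  gauge integral; both agree with the interval Lebesgue integrals once t is positive and at least
  \<open>a\<close>. Vectors are indexed from 0, so \<alpha> (Suc l) belongs to the exponent
  \<open>d l\<close>.\<close>

definition rep :: "(real \<Rightarrow> real) \<Rightarrow> (nat \<Rightarrow> real) \<Rightarrow> real \<Rightarrow> (real \<Rightarrow> real) \<Rightarrow> bool" where
  "rep f \<alpha> a \<epsilon> \<longleftrightarrow> a > 0 \<and> \<epsilon> \<in> borel_measurable (lebesgue_on {a..}) \<and> (\<epsilon> \<longlongrightarrow> 0) at_top \<and>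
     (\<forall>t\<ge>a. (\<lambda>u. (\<alpha> n + \<epsilon> u) * g u * inverse u) absolutely_integrable_on {a..t}) \<and>
     (\<lambda>t. f t - (\<alpha> 0 + (\<Sum>l<n-1. \<alpha> (Suc l) * powint (d l) t)
        + integral {a..t} (\<lambda>u. (\<alpha> n + \<epsilon> u) * g u * inverse u))) \<in> o[at_top](g)"

lemma sum_last: "(\<Sum>l<n. F l) = (\<Sum>l<n-1. F l) + (F (n - 1) :: real)"
  using n sum.lessThan_Suc[of F "n - 1"] by simp

text \<open>The last row of a unit upper triangular matrix is a unit vector, so the last
  eigen-coordinate of a rate vector is its last component.\<close>

lemma sum_last_row: "(\<Sum>l<n. P $$ (n - 1, l) * F l) = (F (n - 1) :: real)"
proof -
  have "(\<Sum>l<n-1. P $$ (n - 1, l) * F l) = 0"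
    using upper_triangularD[OF P_upper] P n by (intro sum.neutral) auto
  then show ?thesis using P_diag[of "n - 1"] n by (simp add: sum_last)
qed

text \<open>In eigen-coordinates the increments of f are sums of \<kappa> l h_l(x) \<gamma> l t. For
  l < n - 1, where \<gamma> l t is C l t^(d l) + o(g), such a term is up to o(g) the increment of
  \<kappa> l C l \<open>powint (d l)\<close>. Subtracting these functions leaves the scalar problem
  with the last exponent.\<close>

lemma GRV_imp_rep:
  assumes v: "v \<in> RV_vec B" "v $ (n - 1) = g" and f: "f \<in> GRV B v"
  obtains \<alpha> a \<epsilon> where "rep f \<alpha> a \<epsilon>"
proof -
  have dim: "dim_row B = n" using B by simp
  have v_carrier: "v \<in> carrier_vec n"
    using v(1) by (simp add: RV_vec_def rate_vector_def dim)
  then have vt: "vec_at v t \<in> carrier_vec n" for t by (simp add: vec_at_def)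
  define \<gamma> where "\<gamma> l t = (Q *\<^sub>v vec_at v t) $ l" for l t
  have \<gamma>_sum: "\<gamma> l t = (\<Sum>i<n. Q $$ (l, i) * vec_at v t $ i)" if "l < n" for l t
    using that by (simp add: \<gamma>_def index_mult_mat_vec_sum[OF Q vt] del: index_mult_mat_vec)
  have RV: "(\<lambda>t. vec_at v (x * t) $ i - (\<Sum>l<n. P $$ (i, l) * x powr d l * \<gamma> l t)) \<in> o[at_top](g)"
    if "x > 0" "i < n" for x i
  proof -
    have "(\<lambda>t. vec_at v (x * t) $ i - (mat_powr x B *\<^sub>v vec_at v t) $ i) \<in> o[at_top](g)"
      using v that unfolding RV_vec_def dim by auto
    then show ?thesis
      unfolding mat_powr_mult_vec[OF vt that(2,1)] \<gamma>_def .
  qed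
  \<comment> \<open>Multiplication by \<open>Q\<close> decouples the vector relation; finite
    combinations of o(g) errors are again o(g).\<close>
  have \<gamma>_RV: "(\<lambda>t. \<gamma> m (x * t) - x powr d m * \<gamma> m t) \<in> o[at_top](g)" if "x > 0" "m < n" for x m
  proof -
    have "(\<lambda>t. \<Sum>i<n. Q $$ (m, i) * (vec_at v (x * t) $ i - (\<Sum>l<n. P $$ (i, l) * x powr d l * \<gamma> l t))) \<in> o[at_top](g)"
      using RV[OF that(1)] by (intro big_sum_in_smallo) (simp add: cmult_in_smallo_iff del: right_diff_distrib)
    moreover have "(\<Sum>i<n. Q $$ (m, i) * (vec_at v (x * t) $ i - (\<Sum>l<n. P $$ (i, l) * x powr d l * \<gamma> l t)))
        = \<gamma> m (x * t) - x powr d m * \<gamma> m t" for t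
    proof -
      have "(\<Sum>i<n. Q $$ (m, i) * (\<Sum>l<n. P $$ (i, l) * x powr d l * \<gamma> l t))
          = (\<Sum>l<n. (\<Sum>i<n. Q $$ (m, i) * P $$ (i, l)) * (x powr d l * \<gamma> l t))"
        unfolding sum_distrib_left sum_distrib_right by (subst sum.swap) (simp add: mult_ac)
      also have "\<dots> = (\<Sum>l<n. if m = l then x powr d l * \<gamma> l t else 0)"
        using that by (intro sum.cong) (auto simp: sum_QP)
      also have "\<dots> = x powr d m * \<gamma> m t" using that by simp
      finally show ?thesis
        using that by (simp add: \<gamma>_sum right_diff_distrib sum_subtractf)
    qed
    ultimately show ?thesis by simp
  qed
  have \<gamma>_last: "\<gamma> (n - 1) t = g t" for t
  proof -
    have "vec_at v t = P *\<^sub>v (Q *\<^sub>v vec_at v t)"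
      using assoc_mult_mat_vec[OF P Q vt, of t] vt[of t] by (simp add: PQ)
    then have "vec_at v t $ (n - 1) = (\<Sum>l<n. P $$ (n - 1, l) * \<gamma> l t)"
      using n index_mult_mat_vec_sum[OF P mult_mat_vec_carrier[OF Q vt[of t]], of "n - 1"]
      by (simp add: \<gamma>_def)
    then show ?thesis
      using sum_last_row[of "\<lambda>l. \<gamma> l t"] v(2) v_carrier n by (simp add: vec_at_def)
  qed
  have "\<exists>C. (\<lambda>t. \<gamma> l t - C * t powr d l) \<in> o[at_top](g)" if "l < n - 1" for l
  proof (rule power_asymptotics)
    show "d (n - 1) < d l" using that by (intro d_decreasing) auto
    show "(\<lambda>t. \<gamma> l (x * t) - x powr d l * \<gamma> l t) \<in> o[at_top](g)" if "x \<ge> 1" for x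
      using that \<open>l < n - 1\<close> by (intro \<gamma>_RV) auto
  qed
  then obtain C where C: "\<And>l. l < n - 1 \<Longrightarrow> (\<lambda>t. \<gamma> l t - C l * t powr d l) \<in> o[at_top](g)"
    by metis
  obtain c where c: "c \<in> carrier_mat 1 n"
    "\<And>x. x > 0 \<Longrightarrow> (\<lambda>t. f (x * t) - (f t + ((c * mat_powr_integral B x) *\<^sub>v vec_at v t) $ 0)) \<in> o[at_top](g)"
    using f v(2) unfolding GRV_def dim by auto
  define \<kappa> where "\<kappa> l = (\<Sum>i<n. c $$ (0, i) * P $$ (i, l))" for l
  have f_incr: "(\<lambda>t. f (x * t) - (f t + (\<Sum>l<n. \<kappa> l * powint (d l) x * \<gamma> l t))) \<in> o[at_top](g)" if "x > 0" for x
    using c(2)[OF that] unfolding mat_powr_integral_mult_vec[OF c(1) vt that] \<kappa>_def \<gamma>_def .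
  define f0 where "f0 t = f t - (\<Sum>l<n-1. \<kappa> l * C l * powint (d l) t)" for t
  have f0_incr: "incr f0 (\<kappa> (n - 1))"
    unfolding incr_def
  proof (intro allI impI)
    fix x :: real assume x: "x > 0"
    have "(\<lambda>t. \<Sum>l<n-1. \<kappa> l * powint (d l) x * (\<gamma> l t - C l * t powr d l)) \<in> o[at_top](g)"
      using C by (intro big_sum_in_smallo) (simp del: right_diff_distrib)
    from sum_in_smallo(1)[OF f_incr[OF x] this]
    show "(\<lambda>t. f0 (x * t) - f0 t - \<kappa> (n - 1) * powint (d (n - 1)) x * g t) \<in> o[at_top](g)"
    proof (rule landau_o.small.in_cong[THEN iffD1, rotated])
      show "\<forall>\<^sub>F t in at_top. f (x * t) - (f t + (\<Sum>l<n. \<kappa> l * powint (d l) x * \<gamma> l t))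
            + (\<Sum>l<n-1. \<kappa> l * powint (d l) x * (\<gamma> l t - C l * t powr d l))
          = f0 (x * t) - f0 t - \<kappa> (n - 1) * powint (d (n - 1)) x * g t"
        using eventually_gt_at_top[of 0]
      proof eventually_elim
        case (elim t)
        \<comment> \<open>The cocycle relation with t as the first factor, so that the power of t
          appears.\<close>
        have "powint (d l) (x * t) = powint (d l) t + t powr d l * powint (d l) x" for l
          using powint_mult[OF elim x] by (simp add: mult.commute)
        then show ?case
          unfolding f0_def sum_last
          by (simp add: \<gamma>_last algebra_simps sum.distrib sum_subtractf del: One_nat_def)
      qed
    qed
  qed
  have f0_meas: "measurable_near_top f0"
  proof -
    obtain t0 where "f \<in> borel_measurable (lebesgue_on {t0..})"
      using f unfolding GRV_def measurable_near_top_def by auto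
    then have "f \<in> borel_measurable (lebesgue_on {max t0 1..})"
      by (rule measurable_restrict_mono) auto
    moreover have "(\<lambda>t. \<Sum>l<n-1. \<kappa> l * C l * powint (d l) t) \<in> borel_measurable (lebesgue_on {max t0 1..})"
      by (rule continuous_imp_measurable_on_sets_lebesgue) (auto intro!: continuous_intros)
    ultimately have "f0 \<in> borel_measurable (lebesgue_on {max t0 1..})"
      unfolding f0_def[abs_def] by (rule borel_measurable_diff)
    then show ?thesis unfolding measurable_near_top_def by blast
  qed
  obtain a a0 \<epsilon> where rep0: "a > 0" "\<epsilon> \<in> borel_measurable (lebesgue_on {a..})" "(\<epsilon> \<longlongrightarrow> 0) at_top"
    "\<And>t. t \<ge> a \<Longrightarrow> (\<lambda>u. (\<kappa> (n - 1) + \<epsilon> u) * g u * inverse u) absolutely_integrable_on {a..t}"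
    "(\<lambda>t. f0 t - (a0 + integral {a..t} (\<lambda>u. (\<kappa> (n - 1) + \<epsilon> u) * g u * inverse u))) \<in> o[at_top](g)"
    by (rule integral_representation[OF f0_meas f0_incr]) (rule that)
  \<comment> \<open>Power terms occupy the slots l + 1 < n, so the three cases do not
    collide.\<close>
  define \<alpha> where "\<alpha> i = (if i = 0 then a0 else if i = n then \<kappa> (n - 1) else \<kappa> (i - 1) * C (i - 1))" for i
  have \<alpha>: "\<alpha> 0 = a0" "\<alpha> n = \<kappa> (n - 1)" "\<And>l. l < n - 1 \<Longrightarrow> \<alpha> (Suc l) = \<kappa> l * C l"
    using n by (auto simp: \<alpha>_def)
  have "rep f \<alpha> a \<epsilon>"
    unfolding rep_def \<alpha>(1,2)
  proof (intro conjI allI impI rep0(1-4))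
    have "f0 t - (a0 + integral {a..t} (\<lambda>u. (\<kappa> (n - 1) + \<epsilon> u) * g u * inverse u))
        = f t - (a0 + (\<Sum>l<n-1. \<alpha> (Suc l) * powint (d l) t)
          + integral {a..t} (\<lambda>u. (\<kappa> (n - 1) + \<epsilon> u) * g u * inverse u))" for t
      by (simp add: f0_def \<alpha>(3))
    then show "(\<lambda>t. f t - (a0 + (\<Sum>l<n-1. \<alpha> (Suc l) * powint (d l) t)
          + integral {a..t} (\<lambda>u. (\<kappa> (n - 1) + \<epsilon> u) * g u * inverse u))) \<in> o[at_top](g)"
      using rep0(5) by (simp only:)
  qed
  then show thesis by (rule that)
qed

section \<open>A rate vector made of pure powers and the prescribed last component\<close>

definition base_rate :: "nat \<Rightarrow> real \<Rightarrow> real" where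
  "base_rate l t = (if l < n - 1 then t powr d l else g t)"

text \<open>Its eigen-coordinates are exact solutions t^(d l) of the scalar relations, apart from
  the last one, which is \<open>g\<close>.\<close>

definition rate :: "(real \<Rightarrow> real) vec" where
  "rate = vec n (\<lambda>i t. \<Sum>l<n. P $$ (i, l) * base_rate l t)"

lemma rate_carrier: "rate \<in> carrier_vec n"
  by (simp add: rate_def)

lemma rate_last: "rate $ (n - 1) = g"
proof
  show "(rate $ (n - 1)) t = g t" for t
    using n sum_last_row[of "\<lambda>l. base_rate l t"] by (simp add: rate_def base_rate_def)
qed

lemma Q_rate:
  assumes "m < n"
  shows "(Q *\<^sub>v vec_at rate t) $ m = base_rate m t"
proof -
  have "vec_at rate t \<in> carrier_vec n" by (simp add: vec_at_def rate_def)
  then have "(Q *\<^sub>v vec_at rate t) $ m = (\<Sum>i<n. Q $$ (m, i) * (\<Sum>l<n. P $$ (i, l) * base_rate l t))"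
    using assms by (simp add: index_mult_mat_vec_sum[OF Q] vec_at_def rate_def del: index_mult_mat_vec)
  also have "\<dots> = (\<Sum>l<n. (\<Sum>i<n. Q $$ (m, i) * P $$ (i, l)) * base_rate l t)"
    unfolding sum_distrib_left sum_distrib_right by (subst sum.swap) (simp add: mult_ac)
  also have "\<dots> = (\<Sum>l<n. if m = l then base_rate l t else 0)"
    using assms by (intro sum.cong) (auto simp: sum_QP)
  finally show ?thesis using assms by simp
qed

lemma base_rate_smallo:
  assumes "i < j" "j < n"
  shows "base_rate j \<in> o[at_top](base_rate i)"
proof (cases "j < n - 1")
  case True
  then have "base_rate i = (\<lambda>t. t powr d i)" "base_rate j = (\<lambda>t. t powr d j)"
    using assms by (auto simp: base_rate_def)
  then show ?thesis
    using d_decreasing[OF assms] by (simp add: powr_smallo_iff[OF filterlim_ident])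
next
  case False
  then have j: "j = n - 1" using assms by simp
  then have "base_rate i = (\<lambda>t. t powr d i)" "base_rate j = g"
    using assms by (auto simp: base_rate_def)
  then show ?thesis
    using d_decreasing[OF assms] j by (simp add: g_smallo_powr)
qed

text \<open>Row i of the unit upper triangular \<open>P\<close> starts with coefficient 1 at
  \<open>base_rate i\<close>; all later terms are of smaller order.\<close>

lemma rate_diff_smallo:
  assumes i: "i < n"
  shows "(\<lambda>t. (rate $ i) t - base_rate i t) \<in> o[at_top](base_rate i)"
proof -
  have eq: "(rate $ i) t - base_rate i t = (\<Sum>l\<in>{i<..<n}. P $$ (i, l) * base_rate l t)" for t
  proof -
    have un: "{..<n} = {..<i} \<union> insert i {i<..<n}" using i by auto
    have "(\<Sum>l<n. P $$ (i, l) * base_rate l t) = (\<Sum>l<i. P $$ (i, l) * base_rate l t)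
        + (\<Sum>l\<in>insert i {i<..<n}. P $$ (i, l) * base_rate l t)"
      unfolding un by (intro sum.union_disjoint) auto
    also have "(\<Sum>l\<in>insert i {i<..<n}. P $$ (i, l) * base_rate l t)
        = P $$ (i, i) * base_rate i t + (\<Sum>l\<in>{i<..<n}. P $$ (i, l) * base_rate l t)"
      by simp
    finally have "(\<Sum>l<n. P $$ (i, l) * base_rate l t) = (\<Sum>l<i. P $$ (i, l) * base_rate l t)
        + (P $$ (i, i) * base_rate i t + (\<Sum>l\<in>{i<..<n}. P $$ (i, l) * base_rate l t))" .
    moreover have "(\<Sum>l<i. P $$ (i, l) * base_rate l t) = 0"
      using upper_triangularD[OF P_upper] P i by (intro sum.neutral) auto
    ultimately show ?thesis using i P_diag[OF i] by (simp add: rate_def)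
  qed
  show ?thesis
    unfolding eq using base_rate_smallo by (intro big_sum_in_smallo) simp
qed

lemma rate_bigtheta: "i < n \<Longrightarrow> rate $ i \<in> \<Theta>[at_top](base_rate i)"
  by (intro asymp_equiv_imp_bigtheta smallo_imp_asymp_equiv rate_diff_smallo)

lemma rate_vector_rate: "rate_vector n rate"
  unfolding rate_vector_def
proof (intro conjI allI impI rate_carrier)
  fix i assume i: "i < n"
  show "eventually_constant_sign (rate $ i)"
  proof (cases "i < n - 1")
    case True
    have "\<forall>\<^sub>F t in at_top. norm ((rate $ i) t - base_rate i t) \<le> 1 / 2 * norm (base_rate i t)"
      by (rule landau_o.smallD[OF rate_diff_smallo[OF i]]) simp
    then have "\<forall>\<^sub>F t in at_top. (rate $ i) t > 0"
      using eventually_gt_at_top[of 0]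
    proof eventually_elim
      case (elim t)
      have "base_rate i t > 0" using elim(2) True by (simp add: base_rate_def)
      then show ?case using elim(1) unfolding real_norm_def by (simp add: abs_if split: if_splits)
    qed
    then show ?thesis by (simp add: eventually_constant_sign_def)
  next
    case False
    then have "i = n - 1" using i by simp
    then show ?thesis using rate_last g_sign by simp
  qed
next
  fix i assume i: "i + 1 < n"
  have "rate $ (i + 1) \<in> O[at_top](base_rate (i + 1))"
    using rate_bigtheta[of "i + 1"] i by (auto dest: bigthetaD1)
  also have "base_rate (i + 1) \<in> o[at_top](base_rate i)"
    using i by (intro base_rate_smallo) auto
  also have "base_rate i \<in> \<Theta>[at_top](rate $ i)"
    using rate_bigtheta[of i] i by (simp add: bigtheta_sym)
  finally show "rate $ (i + 1) \<in> o[at_top](rate $ i)" .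
qed

text \<open>For positive t the powers satisfy their relation exactly, so the only error is that of
  \<open>g\<close>, multiplied by the entry of \<open>P\<close> in the last column.\<close>

lemma rate_RV: "rate \<in> RV_vec B"
proof -
  have dim: "dim_row B = n" using B by simp
  have vt: "vec_at rate t \<in> carrier_vec n" for t by (simp add: vec_at_def rate_def)
  obtain t0 where "g \<in> borel_measurable (lebesgue_on {t0..})"
    using g_meas unfolding measurable_near_top_def by blast
  then have g_meas': "g \<in> borel_measurable (lebesgue_on {max t0 1..})"
    by (rule measurable_restrict_mono) auto
  have base_meas: "base_rate l \<in> borel_measurable (lebesgue_on {max t0 1..})" for l
  proof (cases "l < n - 1")
    case True
    then have "base_rate l = (\<lambda>t. t powr d l)" by (auto simp: base_rate_def)
    then show ?thesis
      by (auto intro!: continuous_imp_measurable_on_sets_lebesgue continuous_intros)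
  next
    case False
    then have "base_rate l = g" by (auto simp: base_rate_def)
    then show ?thesis using g_meas' by simp
  qed
  have meas: "measurable_near_top (rate $ i)" if "i < n" for i
  proof -
    have "(\<lambda>t. \<Sum>l<n. P $$ (i, l) * base_rate l t) \<in> borel_measurable (lebesgue_on {max t0 1..})"
      by (intro borel_measurable_sum borel_measurable_times borel_measurable_const base_meas)
    then show ?thesis
      using that unfolding measurable_near_top_def rate_def by auto
  qed
  have "(\<lambda>t. vec_at rate (x * t) $ i - (mat_powr x B *\<^sub>v vec_at rate t) $ i) \<in> o[at_top](g)"
    if x: "x > 0" and i: "i < n" for x i
  proof -
    have "(\<lambda>t. g (x * t) - g t - d (n - 1) * powint (d (n - 1)) x * g t) \<in> o[at_top](g)"
      using incr_self x unfolding incr_def by blast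
    then have "(\<lambda>t. P $$ (i, n - 1) * (g (x * t) - g t - d (n - 1) * powint (d (n - 1)) x * g t)) \<in> o[at_top](g)"
      by (simp only: cmult_in_smallo_iff) simp
    then show ?thesis
    proof (rule landau_o.small.in_cong[THEN iffD1, rotated])
      show "\<forall>\<^sub>F t in at_top. P $$ (i, n - 1) * (g (x * t) - g t - d (n - 1) * powint (d (n - 1)) x * g t)
          = vec_at rate (x * t) $ i - (mat_powr x B *\<^sub>v vec_at rate t) $ i"
        using eventually_gt_at_top[of 0]
      proof eventually_elim
        case (elim t)
        have "vec_at rate (x * t) $ i - (mat_powr x B *\<^sub>v vec_at rate t) $ i
            = (\<Sum>l<n. P $$ (i, l) * (base_rate l (x * t) - x powr d l * base_rate l t))"
        proof -
          have "vec_at rate (x * t) $ i = (\<Sum>l<n. P $$ (i, l) * base_rate l (x * t))"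
            using i by (simp add: vec_at_def rate_def)
          then show ?thesis
            unfolding mat_powr_mult_vec[OF vt i x]
            by (simp add: Q_rate right_diff_distrib sum_subtractf mult.assoc)
        qed
        also have "\<dots> = P $$ (i, n - 1) * (g (x * t) - x powr d (n - 1) * g t)"
          unfolding sum_last using elim x by (simp add: base_rate_def powr_mult)
        finally show ?case using powr_eq_powint[OF x, of "d (n - 1)"] by (simp add: algebra_simps)
      qed
    qed
  qed
  then show ?thesis
    unfolding RV_vec_def dim using rate_vector_rate meas rate_last by auto
qed

text \<open>The row vector must satisfy c P = (\<alpha> 1, ..., \<alpha> n), hence c is (\<alpha> 1,
  ..., \<alpha> n) Q. The power terms then match exactly, the integral contributes the last
  coordinate up to o(g), and the remainder stays o(g) under scaling.\<close>

lemma rep_imp_GRV: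
  assumes f: "measurable_near_top f" and r: "rep f \<alpha> a \<epsilon>"
  shows "f \<in> GRV B rate"
proof -
  have dim: "dim_row B = n" using B by simp
  have vt: "vec_at rate t \<in> carrier_vec n" for t by (simp add: vec_at_def rate_def)
  define J where "J t = integral {a..t} (\<lambda>u. (\<alpha> n + \<epsilon> u) * g u * inverse u)" for t
  define r where "r t = f t - (\<alpha> 0 + (\<Sum>l<n-1. \<alpha> (Suc l) * powint (d l) t) + J t)" for t
  have a: "a > 0" and r: "r \<in> o[at_top](g)"
    using r unfolding rep_def r_def[abs_def] J_def by auto
  have J: "incr J (\<alpha> n)"
    unfolding J_def
  proof (rule incr_integral[OF a])
    show "(\<lambda>u. (\<alpha> n + \<epsilon> u) * g u * inverse u) integrable_on {a..t}" for t
    proof (cases "t \<ge> a")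
      case True
      then show ?thesis
        using \<open>rep f \<alpha> a \<epsilon>\<close> unfolding rep_def by (auto intro: set_lebesgue_integral_eq_integral(1))
    qed (simp add: integrable_on_empty)
    have "(\<lambda>t. \<epsilon> t * g t) \<in> o[at_top](g)"
    proof -
      have "\<epsilon> \<in> o[at_top](\<lambda>_. 1)"
        using \<open>rep f \<alpha> a \<epsilon>\<close> unfolding rep_def by (intro smalloI_tendsto) auto
      from landau_o.small_big_mult[OF this, of g g] show ?thesis by simp
    qed
    then show "(\<lambda>t. t * ((\<alpha> n + \<epsilon> t) * g t * inverse t) - \<alpha> n * g t) \<in> o[at_top](g)"
    proof (rule landau_o.small.in_cong[THEN iffD1, rotated])
      show "\<forall>\<^sub>F t in at_top. \<epsilon> t * g t = t * ((\<alpha> n + \<epsilon> t) * g t * inverse t) - \<alpha> n * g t"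
        using eventually_gt_at_top[of 0] by eventually_elim (simp add: field_simps)
    qed
  qed
  define c where "c = mat 1 n (\<lambda>(_, j). \<Sum>m<n. \<alpha> (Suc m) * Q $$ (m, j))"
  have c: "c \<in> carrier_mat 1 n" by (simp add: c_def)
  have c_sum: "(\<Sum>i<n. c $$ (0, i) * P $$ (i, l)) = \<alpha> (Suc l)" if "l < n" for l
  proof -
    have "(\<Sum>i<n. c $$ (0, i) * P $$ (i, l)) = (\<Sum>m<n. \<alpha> (Suc m) * (\<Sum>i<n. Q $$ (m, i) * P $$ (i, l)))"
      unfolding sum_distrib_left
      by (subst sum.swap) (simp add: c_def sum_distrib_right mult.assoc)
    also have "\<dots> = (\<Sum>m<n. if m = l then \<alpha> (Suc m) else 0)"
      using that by (intro sum.cong) (auto simp: sum_QP)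
    finally show ?thesis using that by simp
  qed
  have "(\<lambda>t. f (x * t) - (f t + ((c * mat_powr_integral B x) *\<^sub>v vec_at rate t) $ 0)) \<in> o[at_top](g)"
    if x: "x > 0" for x
  proof -
    have "(\<lambda>t. (r (x * t) - r t) + (J (x * t) - J t - \<alpha> n * powint (d (n - 1)) x * g t)) \<in> o[at_top](g)"
      using J x unfolding incr_def by (intro sum_in_smallo(1) sum_in_smallo(2)[OF smallo_scale[OF r x] r]) auto
    then show ?thesis
    proof (rule landau_o.small.in_cong[THEN iffD1, rotated])
      show "\<forall>\<^sub>F t in at_top. (r (x * t) - r t) + (J (x * t) - J t - \<alpha> n * powint (d (n - 1)) x * g t)
          = f (x * t) - (f t + ((c * mat_powr_integral B x) *\<^sub>v vec_at rate t) $ 0)"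
        using eventually_gt_at_top[of 0]
      proof eventually_elim
        case (elim t)
        have "((c * mat_powr_integral B x) *\<^sub>v vec_at rate t) $ 0
            = (\<Sum>l<n. \<alpha> (Suc l) * powint (d l) x * base_rate l t)"
          unfolding mat_powr_integral_mult_vec[OF c vt x] by (intro sum.cong) (auto simp: c_sum Q_rate)
        also have "\<dots> = (\<Sum>l<n-1. \<alpha> (Suc l) * powint (d l) x * t powr d l) + \<alpha> n * powint (d (n - 1)) x * g t"
          unfolding sum_last using n by (simp add: base_rate_def)
        finally have eq: "((c * mat_powr_integral B x) *\<^sub>v vec_at rate t) $ 0 = \<dots>" .
        have "powint (d l) (x * t) = powint (d l) t + t powr d l * powint (d l) x" for l
          using powint_mult[OF elim x] by (simp add: mult.commute)
        then show ?case
          unfolding eq r_def by (simp add: algebra_simps sum.distrib)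
      qed
    qed
  qed
  then show ?thesis
    unfolding GRV_def dim using f c rate_last by auto
qed

end

section \<open>The equivalence in terms of interval Lebesgue integrals\<close>

theorem theorem7p4:
  fixes n :: nat and B :: "real mat" and f gn :: "real \<Rightarrow> real"
  assumes "n \<ge> 2"
    and "B \<in> carrier_mat n n"
    and "upper_triangular B"
    and "\<forall>i. i + 1 < n \<longrightarrow> B $$ (i, i) > B $$ (i + 1, i + 1)"
    and "measurable_near_top f"
    and "measurable_near_top gn"
    and "eventually_constant_sign gn"
    and "regularly_varying (B $$ (n - 1, n - 1)) (\<lambda>t. \<bar>gn t\<bar>)"
  shows "(\<exists>g. g \<in> RV_vec B \<and> g $ (n - 1) = gn \<and> f \<in> GRV B g) \<longleftrightarrow>
    (\<exists>(a::real) (\<alpha> :: nat \<Rightarrow> real) (\<epsilon> :: real \<Rightarrow> real).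
       a > 0 \<and>
       \<epsilon> \<in> borel_measurable (lebesgue_on {a..}) \<and>
       (\<epsilon> \<longlongrightarrow> 0) at_top \<and>
       (\<forall>t\<ge>a. interval_lebesgue_integrable lebesgue (ereal a) (ereal t)
                 (\<lambda>u. (\<alpha> n + \<epsilon> u) * gn u * inverse u)) \<and>
       (\<lambda>t. f t - (\<alpha> 0
           + (\<Sum>i=1..n-1. \<alpha> i * (LINT u=ereal 1..ereal t|lebesgue. (u powr (B $$ (i - 1, i - 1) - 1))))
           + (LINT u=ereal a..ereal t|lebesgue. ((\<alpha> n + \<epsilon> u) * gn u * inverse u))))
         \<in> o[at_top](gn))"
proof -
  define d where "d i = B $$ (i, i)" for i
  \<comment> \<open>The hypothesis compares neighbouring diagonal entries; induction extends it to
    all pairs.\<close>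
  have d_decreasing: "d j < d i" if "i < j" "j < n" for i j
    using that
  proof (induction j)
    case (Suc j)
    have "d (Suc j) < d j" using assms(4) Suc.prems by (simp add: d_def)
    then show ?case using Suc by (cases "i = j") auto
  qed simp
  obtain P Q where PQ: "P \<in> carrier_mat n n" "Q \<in> carrier_mat n n" "P * Q = 1\<^sub>m n" "Q * P = 1\<^sub>m n"
    "upper_triangular P" "\<And>i. i < n \<Longrightarrow> P $$ (i, i) = 1" "B * P = P * mat_diag n d"
  proof (rule upper_triangular_diagonalization[OF assms(2,3)])
    show "B $$ (i, i) \<noteq> B $$ (j, j)" if "i < j" "j < n" for i j
      using d_decreasing[OF that] by (simp add: d_def)
  qed (use that in \<open>simp add: d_def[abs_def]\<close>)
  \<comment> \<open>Numerator and denominator eventually have the same sign, so the absolute values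
    drop out of the ratio.\<close>
  have lim: "((\<lambda>t. gn (x * t) / gn t) \<longlongrightarrow> x powr d (n - 1)) at_top" if x: "x > 0" for x
  proof -
    have "((\<lambda>t. \<bar>gn (x * t)\<bar> / \<bar>gn t\<bar>) \<longlongrightarrow> x powr d (n - 1)) at_top"
      using assms(8) x by (simp add: regularly_varying_def d_def)
    then show ?thesis
    proof (rule Lim_transform_eventually)
      have x_lim: "filterlim (\<lambda>t. x * t) at_top at_top"
        by (intro filterlim_tendsto_pos_mult_at_top[OF tendsto_const x] filterlim_ident)
      from assms(7) show "\<forall>\<^sub>F t in at_top. \<bar>gn (x * t)\<bar> / \<bar>gn t\<bar> = gn (x * t) / gn t"
        unfolding eventually_constant_sign_def
      proof
        assume pos: "\<forall>\<^sub>F t in at_top. gn t > 0"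
        show ?thesis
          using pos eventually_compose_filterlim[OF pos x_lim] by eventually_elim simp
      next
        assume neg: "\<forall>\<^sub>F t in at_top. gn t < 0"
        show ?thesis
          using neg eventually_compose_filterlim[OF neg x_lim] by eventually_elim simp
      qed
    qed
  qed
  interpret triangular_rate n B P Q d gn
    by unfold_locales (use assms PQ lim d_decreasing in auto)
  \<comment> \<open>The congruence rule for conjunctions makes integrability available in the last
    conjunct, where the Lebesgue and gauge integrals are identified.\<close>
  have rep_iff: "rep f \<alpha> a \<epsilon> \<longleftrightarrow> a > 0 \<and> \<epsilon> \<in> borel_measurable (lebesgue_on {a..}) \<and> (\<epsilon> \<longlongrightarrow> 0) at_top \<and>
       (\<forall>t\<ge>a. interval_lebesgue_integrable lebesgue (ereal a) (ereal t)
                 (\<lambda>u. (\<alpha> n + \<epsilon> u) * gn u * inverse u)) \<and>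
       (\<lambda>t. f t - (\<alpha> 0
           + (\<Sum>i=1..n-1. \<alpha> i * (LINT u=ereal 1..ereal t|lebesgue. (u powr (B $$ (i - 1, i - 1) - 1))))
           + (LINT u=ereal a..ereal t|lebesgue. ((\<alpha> n + \<epsilon> u) * gn u * inverse u))))
         \<in> o[at_top](gn)" for \<alpha> a \<epsilon>
    unfolding rep_def
  proof (intro conj_cong refl)
    show int_iff: "(\<forall>t\<ge>a. (\<lambda>u. (\<alpha> n + \<epsilon> u) * gn u * inverse u) absolutely_integrable_on {a..t}) \<longleftrightarrow>
      (\<forall>t\<ge>a. interval_lebesgue_integrable lebesgue (ereal a) (ereal t) (\<lambda>u. (\<alpha> n + \<epsilon> u) * gn u * inverse u))"
      by (simp add: interval_lebesgue_integrable_iff_absolutely_integrable)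
    assume "\<forall>t\<ge>a. interval_lebesgue_integrable lebesgue (ereal a) (ereal t) (\<lambda>u. (\<alpha> n + \<epsilon> u) * gn u * inverse u)"
    then have int: "(\<lambda>u. (\<alpha> n + \<epsilon> u) * gn u * inverse u) absolutely_integrable_on {a..t}" if "t \<ge> a" for t
      using that int_iff by blast
    show "(\<lambda>t. f t - (\<alpha> 0 + (\<Sum>l<n-1. \<alpha> (Suc l) * powint (d l) t)
            + integral {a..t} (\<lambda>u. (\<alpha> n + \<epsilon> u) * gn u * inverse u))) \<in> o[at_top](gn) \<longleftrightarrow>
      (\<lambda>t. f t - (\<alpha> 0
           + (\<Sum>i=1..n-1. \<alpha> i * (LINT u=ereal 1..ereal t|lebesgue. (u powr (B $$ (i - 1, i - 1) - 1))))
           + (LINT u=ereal a..ereal t|lebesgue. ((\<alpha> n + \<epsilon> u) * gn u * inverse u))))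
         \<in> o[at_top](gn)"
    proof (rule landau_o.small.in_cong)
      show "\<forall>\<^sub>F t in at_top. f t - (\<alpha> 0 + (\<Sum>l<n-1. \<alpha> (Suc l) * powint (d l) t)
            + integral {a..t} (\<lambda>u. (\<alpha> n + \<epsilon> u) * gn u * inverse u))
        = f t - (\<alpha> 0
           + (\<Sum>i=1..n-1. \<alpha> i * (LINT u=ereal 1..ereal t|lebesgue. (u powr (B $$ (i - 1, i - 1) - 1))))
           + (LINT u=ereal a..ereal t|lebesgue. ((\<alpha> n + \<epsilon> u) * gn u * inverse u)))"
        \<comment> \<open>Positivity serves the closed form of the integrals from 1 to
          \<open>t\<close>; t \<ge> a fixes the orientation of the last integral.\<close>
        using eventually_gt_at_top[of 0] eventually_ge_at_top[of a]
      proof eventually_elim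
        case (elim t)
        then show ?case
          unfolding interval_lebesgue_integral_eq_HK[OF elim(2) int[OF elim(2)]]
          by (simp add: sum.atLeast1_atMost_eq interval_lebesgue_integral_powr d_def)
      qed
    qed
  qed
  show ?thesis
    unfolding rep_iff[symmetric]
  proof
    assume "\<exists>g. g \<in> RV_vec B \<and> g $ (n - 1) = gn \<and> f \<in> GRV B g"
    then obtain v where "v \<in> RV_vec B" "v $ (n - 1) = gn" "f \<in> GRV B v" by blast
    then show "\<exists>a \<alpha> \<epsilon>. rep f \<alpha> a \<epsilon>" by (rule GRV_imp_rep) blast
  next
    assume "\<exists>a \<alpha> \<epsilon>. rep f \<alpha> a \<epsilon>"
    then show "\<exists>g. g \<in> RV_vec B \<and> g $ (n - 1) = gn \<and> f \<in> GRV B g"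
      using rate_RV rate_last rep_imp_GRV[OF assms(5)] by blast
  qed
qed

end
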